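(* Let $0\le p_i<1/2$ for $i=1,2,\ldots$, and let $X_0=0,X_1,X_2,\ldots$ be the nearest neighbor random walk on $\{0,1,2,\ldots\}$ with parameters $\{p_i\}_{i\ge 1}$. Assume that it is transient. For $n\ge 1$ let $$D(n)=1+\sum_{j=1}^{\infty}\prod_{i=1}^{j}U_{n+i},\qquad U_i=\frac{1/2-p_i}{1/2+p_i},$$ which is finite by transience. (i) If $$\sum_{n=2}^\infty\frac1{D(n)\log n}<\infty,$$ then almost surely $\{X_n\}$ has only finitely many cutpoints. (ii) If there exist $\delta>0$ and $n_0$ such that $D(n)\le \delta\, n\log n$ for all $n\ge n_0$, and $$\sum_{n=2}^\infty\frac1{D(n)\log n}=\infty,$$ then almost surely $\{X_n\}$ has infinitely many strong cutpoints.
   Context: The nearest neighbor random walk with parameters $\{p_i\}_{i\ge1}$ is the Markov chain on $\{0,1,2,\ldots\}$ with $X_0=0$ and transition probabilities $\mathbf P(X_{n+1}=1\mid X_n=0)=1$ and, for $i\ge 1$, $\mathbf P(X_{n+1}=i+1\mid X_n=i)=1/2+p_i=1-\mathbf P(X_{n+1}=i-1\mid X_n=i)$. It is transient if and only if $\sum_{k=1}^\infty\prod_{i=1}^k U_i<\infty$. A site $R$ is a cutpoint if for some $k$ we have $X_k=R$, $X_i\le R$ for $i=0,1,\ldots,k$, and $X_i>R$ for all $i\ge k+1$. A site $R$ is a strong cutpoint if for some $k$ we have $X_k=R$, $X_i<R$ for $i=0,1,\ldots,k-1$, and $X_i>R$ for all $i\ge k+1$ (equivalently, $R$ is visited exactly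 once by the walk). *)

theory Defs
  imports "HOL-Probability.Probability"
begin

text \<open>The value \<open>p 0\<close> plays no role: from 0 the walk always moves to 1.\<close>

definition step_prob :: "(nat \<Rightarrow> real) \<Rightarrow> nat \<Rightarrow> nat \<Rightarrow> real" where
  "step_prob p i j =
    (if i = 0 then (if j = 1 then 1 else 0)
     else if j = i + 1 then 1 / 2 + p i
     else if j = i - 1 then 1 - (1 / 2 + p i)
     else 0)"

locale nn_walk = prob_space M for M :: "'a measure" +
  fixes p :: "nat \<Rightarrow> real" and X :: "nat \<Rightarrow> 'a \<Rightarrow> nat"
  assumes random_variable_X: "\<And>n. random_variable (count_space UNIV) (X n)"
    and start: "AE \<omega> in M. X 0 \<omega> = 0"
    and markov: "\<And>n x j. \<P>(\<omega> in M. \<forall>i\<le>n. X i \<omega> = x i) > 0 \<Longrightarrow>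
      \<P>(\<omega> in M. X (Suc n) \<omega> = j \<bar> \<forall>i\<le>n. X i \<omega> = x i) = step_prob p (x n) j"

text \<open>Transience of a chain: every state is left forever with positive probability. By
  homogeneity the return probability of a state \<open>i\<close> is the probability of a visit after time
  \<open>n\<close> given \<open>X n = i\<close>, for any \<open>n\<close> at which \<open>i\<close> is occupied with positive probability.\<close>

definition transient :: "'a measure \<Rightarrow> (nat \<Rightarrow> 'a \<Rightarrow> nat) \<Rightarrow> bool" where
  "transient M X \<longleftrightarrow>
    (\<forall>i n. \<P>(\<omega> in M. X n \<omega> = i) > 0 \<longrightarrow>
      \<P>(\<omega> in M. (\<exists>m>n. X m \<omega> = i) \<bar> X n \<omega> = i) < 1)"

definition U :: "(nat \<Rightarrow> real) \<Rightarrow> nat \<Rightarrow> real" where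
  "U p i = (1 / 2 - p i) / (1 / 2 + p i)"

text \<open>The summation index is shifted by one, so that \<open>j = 0\<close> here is the term with the single
  factor \<open>U p (n + 1)\<close>. The series is meaningful only where it is summable.\<close>

definition D :: "(nat \<Rightarrow> real) \<Rightarrow> nat \<Rightarrow> real" where
  "D p n = 1 + (\<Sum>j. \<Prod>i = 1..Suc j. U p (n + i))"

definition cutpoint :: "(nat \<Rightarrow> nat) \<Rightarrow> nat \<Rightarrow> bool" where
  "cutpoint x R \<longleftrightarrow> (\<exists>k. x k = R \<and> (\<forall>i\<le>k. x i \<le> R) \<and> (\<forall>i\<ge>k + 1. x i > R))"

definition strong_cutpoint :: "(nat \<Rightarrow> nat) \<Rightarrow> nat \<Rightarrow> bool" where
  "strong_cutpoint x R \<longleftrightarrow> (\<exists>k. x k = R \<and> (\<forall>i<k. x i < R) \<and> (\<forall>i\<ge>k + 1. x i > R))"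

end

(* For an escaping walk, R is a cutpoint iff R is never hit after the first visit to R + 1, and a
   first-step analysis of the probability of never hitting R gives P(R is a cutpoint) = 1 / D(R).
   By the strong Markov property the cutpoints have a renewal structure: for R' < R, given that R
   is a cutpoint and given the later cutpoints, R' is a cutpoint with probability
   1 / (1 + U_{R'+1} + ... + U_{R'+1} ... U_R) >= 1 / (R + 1 - R').
   (i) Hence a dyadic block [2^k, 2^(k+1)) that contains a cutpoint has on average at least c k of
   them in itself and its predecessor, so the probability that it contains one is at most
   C sum 1 / (D(n) log n) over these two blocks, and Borel-Cantelli applies.
   (ii) Apply the second moment method to the sum of 1 / log j over the strong cutpoints j. For
   k < j^2 the excess correlation of the pair (j, k) is at most 1 / (D(j) (k - j)), and the weights
   make its sum over k bounded; for k >= j^2 the hypothesis on D makes the pair nearly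
   independent. The event therefore has positive probability, and a 0-1 law finishes the proof. *)
theory Submission
  imports Defs
begin

subsection \<open>Path space\<close>

text \<open>The Markov property is given for finite histories of one process started at 0, while
  first-step analysis compares walks from all states. The argument therefore lives on path space
  with a family of laws \<open>Q i\<close>, obtained at the end by conditioning on the straight
  ascent 0, 1, ..., i. Every pair probability for j < k is governed by how much of D(j) its first k
  - j + 1 terms have already collected. The recursion D(m) - 1 = U_{m+1} D(m+1) turns the missing
  fraction into the product of 1 - 1/D(m) over j \<le> m \<le> k, which is at most exp of minus the
  sum of the 1/D(m). Under D(m) \<le> \<delta> m log m this sum is at least (log log k - log log j)
  / \<delta>, hence at least log 2 / \<delta> once k \<ge> j^2. This explains the threshold: before
  j^2 the excess terms 1 / (k - j) add up to about 2 log j, which the weight 1 / log k just absorbs;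
  beyond it a fixed fraction of D(j) has been collected, so correlation costs only a constant
  factor. Such a factor is harmless, because all that is needed is a positive lower bound that is
  the same for every block.\<close>

definition path_space :: "(nat \<Rightarrow> nat) measure" where
  "path_space = Pi\<^sub>M UNIV (\<lambda>_. count_space UNIV)"

definition path_shift :: "nat \<Rightarrow> (nat \<Rightarrow> nat) \<Rightarrow> nat \<Rightarrow> nat" where
  "path_shift n x = (\<lambda>k. x (n + k))"

definition cylinder :: "nat \<Rightarrow> (nat \<Rightarrow> nat) \<Rightarrow> (nat \<Rightarrow> nat) set" where
  "cylinder n y = {x. \<forall>k\<le>n. x k = y k}"

text \<open>The events of the natural filtration at time \<open>n\<close>. Invariance under changes
  after time \<open>n\<close> is easy to check, and as the state space is countable it already
  implies measurability.\<close>

definition determined :: "nat \<Rightarrow> (nat \<Rightarrow> nat) set \<Rightarrow> bool" where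
  "determined n A \<longleftrightarrow> (\<forall>x y. (\<forall>k\<le>n. x k = y k) \<longrightarrow> x \<in> A \<longrightarrow> y \<in> A)"

lemma space_path_space [simp]: "space path_space = UNIV"
  by (simp add: path_space_def space_PiM)

lemma measurable_coordinate [measurable]: "(\<lambda>x. x k) \<in> path_space \<rightarrow>\<^sub>M count_space UNIV"
  unfolding path_space_def by (rule measurable_component_singleton) simp

lemma measurable_into_path_space:
  assumes "\<And>k. (\<lambda>\<omega>. f \<omega> k) \<in> N \<rightarrow>\<^sub>M count_space UNIV"
  shows "f \<in> N \<rightarrow>\<^sub>M path_space"
proof -
  have "(\<lambda>\<omega>. \<lambda>k\<in>UNIV. f \<omega> k) \<in> N \<rightarrow>\<^sub>M path_space"
    unfolding path_space_def by (rule measurable_restrict) (use assms in auto)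
  then show ?thesis by (simp add: restrict_def)
qed

lemma measurable_path_shift [measurable]: "path_shift n \<in> path_space \<rightarrow>\<^sub>M path_space"
  by (rule measurable_into_path_space) (simp add: path_shift_def)

lemma cylinder_sets [measurable]: "cylinder n y \<in> sets path_space"
proof -
  have "Measurable.pred path_space (\<lambda>x. \<forall>k\<in>{..n}. x k = y k)" by measurable
  then show ?thesis by (simp add: pred_def cylinder_def Ball_def)
qed

lemma path_shift_vimage_sets [measurable]:
  "B \<in> sets path_space \<Longrightarrow> {x. path_shift n x \<in> B} \<in> sets path_space"
  using measurable_sets[OF measurable_path_shift, of B n] by (simp add: vimage_def)

text \<open>Lists index the cylinders because there are only countably many of them, unlike
  functions. The padding by 0 after time \<open>n\<close> is arbitrary: a determined event cannot
  see it.\<close>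

lemma determined_eq_Union_cylinders:
  assumes "determined n A"
  shows "A = (\<Union>l\<in>{l. length l = Suc n \<and> (\<lambda>k. if k \<le> n then l ! k else 0) \<in> A}. cylinder n ((!) l))"
proof (intro equalityI subsetI)
  fix x assume x: "x \<in> A"
  let ?l = "map x [0..<Suc n]"
  have nth: "?l ! k = x k" if "k \<le> n" for k
    using that by (simp add: less_Suc_eq_le nth_append)
  have "(\<lambda>k. if k \<le> n then ?l ! k else 0) \<in> A"
    using assms x unfolding determined_def using nth by (smt (verit, best))
  moreover have "x \<in> cylinder n ((!) ?l)" using nth by (simp add: cylinder_def)
  moreover have "length ?l = Suc n" by simp
  ultimately show "x \<in> (\<Union>l\<in>{l. length l = Suc n \<and> (\<lambda>k. if k \<le> n then l ! k else 0) \<in> A}. cylinder n ((!) l))"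
    by blast
next
  fix x assume "x \<in> (\<Union>l\<in>{l. length l = Suc n \<and> (\<lambda>k. if k \<le> n then l ! k else 0) \<in> A}. cylinder n ((!) l))"
  then obtain l where l: "(\<lambda>k. if k \<le> n then l ! k else 0) \<in> A" "x \<in> cylinder n ((!) l)" by blast
  show "x \<in> A"
    using assms l unfolding determined_def cylinder_def by (smt (verit, best) mem_Collect_eq)
qed

lemma determined_sets: "determined n A \<Longrightarrow> A \<in> sets path_space"
  by (subst determined_eq_Union_cylinders, assumption)
     (intro sets.countable_UN' countableI_type image_subsetI cylinder_sets)

lemma sets_path_space:
  "sets path_space = sigma_sets UNIV (insert {} (range (case_prod cylinder)))" (is "_ = sigma_sets UNIV ?E")
proof (rule antisym)
  show "sigma_sets UNIV ?E \<subseteq> sets path_space"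
    using sets.sigma_sets_subset[of ?E path_space] by (simp add: image_subset_iff cylinder_sets split: prod.splits)
  interpret S: sigma_algebra UNIV "sigma_sets UNIV ?E"
    by (rule sigma_algebra_sigma_sets) simp
  have "{f. f i \<in> A} \<in> sigma_sets UNIV ?E" for i and A :: "nat set"
  proof -
    have "determined i {f. f i \<in> A}" by (simp add: determined_def)
    then have "{f. f i \<in> A} = (\<Union>l\<in>{l. length l = Suc i \<and>
        (\<lambda>k. if k \<le> i then l ! k else 0) \<in> {f. f i \<in> A}}. cylinder i ((!) l))"
      by (rule determined_eq_Union_cylinders)
    also have "\<dots> \<in> sigma_sets UNIV ?E"
      by (intro S.countable_UN' countableI_type) (auto intro!: sigma_sets.Basic)
    finally show ?thesis .
  qed
  moreover have "sets path_space = sigma_sets UNIV {{f. f i \<in> A} | i A. True}"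
    by (simp add: path_space_def sets_PiM_single)
  ultimately show "sets path_space \<subseteq> sigma_sets UNIV ?E"
    by (auto intro!: sigma_sets_mono)
qed

lemma Int_stable_cylinders: "Int_stable (insert {} (range (case_prod cylinder)))"
proof -
  have "cylinder n y \<inter> cylinder m z \<in> insert {} (range (case_prod cylinder))" if "n \<le> m" for n m y z
  proof (cases "\<forall>k\<le>n. z k = y k")
    case True
    then have "cylinder n y \<inter> cylinder m z = case_prod cylinder (m, z)"
      using that by (auto simp: cylinder_def)
    then show ?thesis by blast
  next
    case False
    then have "cylinder n y \<inter> cylinder m z = {}"
      using that by (fastforce simp: cylinder_def)
    then show ?thesis by simp
  qed
  then have "cylinder n y \<inter> cylinder m z \<in> insert {} (range (case_prod cylinder))" for n m y z
    by (metis Int_commute nle_le)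
  then show ?thesis by (auto simp: Int_stable_def)
qed

lemma measure_eqI_cylinders:
  assumes "sets N1 = sets path_space" "sets N2 = sets path_space" "finite_measure N1"
    and eq: "\<And>n y. emeasure N1 (cylinder n y) = emeasure N2 (cylinder n y)"
  shows "N1 = N2"
proof (rule measure_eqI_generator_eq[OF Int_stable_cylinders, where \<Omega> = UNIV and A = "\<lambda>i. cylinder 0 (\<lambda>_. i)"])
  interpret finite_measure N1 by fact
  show "emeasure N1 (cylinder 0 (\<lambda>_. i)) \<noteq> \<infinity>" for i by simp
  show "(\<Union>i. cylinder 0 (\<lambda>_. i)) = UNIV" by (auto simp: cylinder_def)
qed (use assms in \<open>auto simp: sets_path_space\<close>)

section \<open>Markov and strong Markov properties for a family of laws\<close>

lemma prod_lessThan_add: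
  fixes f :: "nat \<Rightarrow> 'a::comm_monoid_mult"
  shows "(\<Prod>k<n + m. f k) = (\<Prod>k<n. f k) * (\<Prod>k<m. f (n + k))"
  by (induction m) (simp_all add: mult.assoc)

text \<open>All that is used of the chain. The cylinder probabilities fix each law
  \<open>Q i\<close>, so the Markov property is a theorem here and not an assumption;
  \<open>return_prob\<close> is transience, with time 0 excluded because the path starts at
  \<open>i\<close>.\<close>

locale walk_laws =
  fixes p :: "nat \<Rightarrow> real" and Q :: "nat \<Rightarrow> (nat \<Rightarrow> nat) measure"
  assumes p_range: "\<And>i. i \<ge> 1 \<Longrightarrow> 0 \<le> p i \<and> p i < 1 / 2"
    and prob_Q: "\<And>i. prob_space (Q i)"
    and sets_Q [measurable_cong]: "\<And>i. sets (Q i) = sets path_space"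
    and cylinder_prob: "\<And>i n y. measure (Q i) (cylinder n y) =
      (if y 0 = i then \<Prod>k<n. step_prob p (y k) (y (Suc k)) else 0)"
    and return_prob: "\<And>i. measure (Q i) {x. \<exists>m>0. x m = i} < 1"
begin

sublocale Q: prob_space "Q i" for i
  by (rule prob_Q)

lemma space_Q [simp]: "space (Q i) = UNIV"
  using sets_eq_imp_space_eq[OF sets_Q] by simp

lemma determined_in_sets: "determined n A \<Longrightarrow> A \<in> sets (Q i)"
  by (simp add: sets_Q determined_sets)

text \<open>As functions of \<open>B\<close> both sides are finite measures, so it is enough to
  compare them on cylinders, where gluing \<open>z\<close> onto \<open>y\<close> gives a longer
  cylinder and the product of step probabilities splits.\<close>

lemma markov_cylinder:
  assumes B: "B \<in> sets path_space"
  shows "measure (Q i) (cylinder n y \<inter> {x. path_shift n x \<in> B}) =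
    measure (Q i) (cylinder n y) * measure (Q (y n)) B"
proof -
  define N1 where "N1 = distr (density (Q i) (indicator (cylinder n y))) path_space (path_shift n)"
  define N2 where "N2 = scale_measure (emeasure (Q i) (cylinder n y)) (Q (y n))"
  have sh: "path_shift n \<in> density (Q i) (indicator (cylinder n y)) \<rightarrow>\<^sub>M path_space"
    by measurable
  have N1: "emeasure N1 B = ennreal (measure (Q i) (cylinder n y \<inter> {x. path_shift n x \<in> B}))"
    if B: "B \<in> sets path_space" for B
  proof -
    have "emeasure N1 B = emeasure (density (Q i) (indicator (cylinder n y))) {x. path_shift n x \<in> B}"
      unfolding N1_def by (subst emeasure_distr[OF sh B]) (simp add: vimage_def)
    also have "\<dots> = emeasure (Q i) (cylinder n y \<inter> {x. path_shift n x \<in> B})"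
      using B by (subst emeasure_restricted) (auto simp: sets_Q)
    finally show ?thesis by (simp add: Q.emeasure_eq_measure)
  qed
  have N2: "emeasure N2 B = ennreal (measure (Q i) (cylinder n y) * measure (Q (y n)) B)" for B
    unfolding N2_def by (simp add: Q.emeasure_eq_measure ennreal_mult)
  have "N1 = N2"
  proof (rule measure_eqI_cylinders)
    show "sets N1 = sets path_space" "sets N2 = sets path_space"
      by (simp_all add: N1_def N2_def sets_Q)
    show "finite_measure N1"
      by (rule finite_measureI)
        (use N1[of UNIV] sets.top[of path_space] in \<open>simp add: N1_def\<close>)
    fix m z
    have "measure (Q i) (cylinder n y \<inter> {x. path_shift n x \<in> cylinder m z}) =
      measure (Q i) (cylinder n y) * measure (Q (y n)) (cylinder m z)"
    \<comment> \<open>Gluing is possible only if \<open>z\<close> starts where \<open>y\<close>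
      ends; otherwise the event on the left is empty and \<open>Q (y n)\<close> gives mass 0 to the
      cylinder of \<open>z\<close>.\<close>
    proof (cases "z 0 = y n")
      case True
      define w where "w k = (if k \<le> n then y k else z (k - n))" for k
      have w1: "w k = y k" if "k \<le> n" for k using that by (simp add: w_def)
      have w2: "w (n + k) = z k" for k using True by (simp add: w_def)
      have "cylinder n y \<inter> {x. path_shift n x \<in> cylinder m z} = cylinder (n + m) w"
      proof (intro equalityI subsetI)
        fix x assume x: "x \<in> cylinder n y \<inter> {x. path_shift n x \<in> cylinder m z}"
        have "x k = w k" if "k \<le> n + m" for k
        proof (cases "k \<le> n")
          case True then show ?thesis using x by (simp add: w1 cylinder_def)
        next
          case False
          define d where "d = k - n"
          have d: "k = n + d" "d \<le> m" using False that by (auto simp: d_def)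
          have "x (n + d) = z d" using x d(2) by (simp add: cylinder_def path_shift_def)
          then show ?thesis using w2[of d] d(1) by simp
        qed
        then show "x \<in> cylinder (n + m) w" by (simp add: cylinder_def)
      next
        fix x assume "x \<in> cylinder (n + m) w"
        then have x: "x k = w k" if "k \<le> n + m" for k using that by (simp add: cylinder_def)
        show "x \<in> cylinder n y \<inter> {x. path_shift n x \<in> cylinder m z}"
          using x w1 w2 by (simp add: cylinder_def path_shift_def)
      qed
      moreover have "(\<Prod>k<n + m. step_prob p (w k) (w (Suc k))) =
        (\<Prod>k<n. step_prob p (y k) (y (Suc k))) * (\<Prod>k<m. step_prob p (z k) (z (Suc k)))"
        unfolding prod_lessThan_add using w2[of "Suc _"]
        by (intro arg_cong2[where f = "(*)"] prod.cong) (simp_all add: w1 w2)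
      ultimately show ?thesis using True by (simp add: cylinder_prob w1)
    next
      case False
      then have "cylinder n y \<inter> {x. path_shift n x \<in> cylinder m z} = {}"
        by (fastforce simp: cylinder_def path_shift_def)
      then show ?thesis using False by (simp add: cylinder_prob)
    qed
    then show "emeasure N1 (cylinder m z) = emeasure N2 (cylinder m z)"
      by (simp add: N1[OF cylinder_sets] N2)
  qed
  then show ?thesis using N1[OF B] N2[of B] by simp
qed

text \<open>Split \<open>A\<close> into its countably many prefixes. All of them end in
  \<open>j\<close>, so the same factor \<open>measure (Q j) B\<close> comes out of every
  summand.\<close>

lemma markov:
  assumes A: "determined n A" "A \<subseteq> {x. x n = j}" and B: "B \<in> sets path_space"
  shows "measure (Q i) (A \<inter> {x. path_shift n x \<in> B}) = measure (Q i) A * measure (Q j) B"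
proof -
  define L where "L = {l :: nat list. length l = Suc n \<and> (\<lambda>k. if k \<le> n then l ! k else 0) \<in> A}"
  have A_eq: "A = (\<Union>l\<in>L. cylinder n ((!) l))"
    unfolding L_def using A(1) by (rule determined_eq_Union_cylinders)
  have disj: "disjoint_family_on (\<lambda>l. cylinder n ((!) l)) L"
  proof -
    have "l = l'" if "l \<in> L" "l' \<in> L" "x \<in> cylinder n ((!) l)" "x \<in> cylinder n ((!) l')" for l l' x
    proof (rule nth_equalityI)
      show "length l = length l'" using that by (simp add: L_def)
      show "l ! k = l' ! k" if "k < length l" for k
        using that \<open>l \<in> L\<close> \<open>x \<in> cylinder n ((!) l)\<close> \<open>x \<in> cylinder n ((!) l')\<close>
        by (simp add: L_def cylinder_def)
    qed
    then show ?thesis unfolding disjoint_family_on_def by blast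
  qed
  have cnt: "countable L" by (rule countableI_type)
  have j: "l ! n = j" if "l \<in> L" for l
    using that A(2) by (auto simp: L_def)
  have m: "{x. path_shift n x \<in> B} \<in> sets (Q i)" using B by (simp add: sets_Q path_shift_vimage_sets)
  have "emeasure (Q i) (A \<inter> {x. path_shift n x \<in> B}) =
    emeasure (Q i) (\<Union>l\<in>L. cylinder n ((!) l) \<inter> {x. path_shift n x \<in> B})"
    by (subst A_eq) (simp add: Int_UN_distrib2)
  also have "\<dots> = (\<integral>\<^sup>+l. emeasure (Q i) (cylinder n ((!) l) \<inter> {x. path_shift n x \<in> B}) \<partial>count_space L)"
    using disj m by (intro emeasure_UN_countable cnt)
      (auto simp: sets_Q disjoint_family_on_def cylinder_sets)
  also have "\<dots> = (\<integral>\<^sup>+l. emeasure (Q i) (cylinder n ((!) l)) * emeasure (Q j) B \<partial>count_space L)"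
    by (intro nn_integral_cong)
      (simp add: Q.emeasure_eq_measure markov_cylinder[OF B] j ennreal_mult)
  also have "\<dots> = (\<integral>\<^sup>+l. emeasure (Q i) (cylinder n ((!) l)) \<partial>count_space L) * emeasure (Q j) B"
    by (rule nn_integral_multc) simp
  also have "(\<integral>\<^sup>+l. emeasure (Q i) (cylinder n ((!) l)) \<partial>count_space L) = emeasure (Q i) A"
    unfolding A_eq using disj by (intro emeasure_UN_countable[symmetric] cnt)
      (auto simp: sets_Q cylinder_sets)
  finally show ?thesis
    by (simp add: Q.emeasure_eq_measure ennreal_mult[symmetric])
qed

text \<open>\<open>G n\<close> stands for the event that a stopping time equals \<open>n\<close>
  while the walk is at \<open>j\<close>; disjointness allows the Markov property to be summed over
  \<open>n\<close>. The union may have probability below 1, so the stopping time may be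
  infinite.\<close>

lemma strong_markov:
  assumes G: "\<And>n. determined n (G n)" "\<And>n. G n \<subseteq> {x. x n = j}" "disjoint_family G"
    and B: "B \<in> sets path_space"
  shows "measure (Q i) (\<Union>n. G n \<inter> {x. path_shift n x \<in> B}) = measure (Q i) (\<Union>n. G n) * measure (Q j) B"
proof -
  have m: "{x. path_shift n x \<in> B} \<in> sets (Q i)" for n using B by (simp add: sets_Q path_shift_vimage_sets)
  have "(\<lambda>n. measure (Q i) (G n \<inter> {x. path_shift n x \<in> B})) sums
      measure (Q i) (\<Union>n. G n \<inter> {x. path_shift n x \<in> B})"
  proof (rule Q.finite_measure_UNION)
    show "range (\<lambda>n. G n \<inter> {x. path_shift n x \<in> B}) \<subseteq> sets (Q i)"
      using m determined_in_sets[OF G(1)] by blast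
    show "disjoint_family (\<lambda>n. G n \<inter> {x. path_shift n x \<in> B})"
      using G(3) unfolding disjoint_family_on_def by blast
  qed
  moreover have "(\<lambda>n. measure (Q i) (G n) * measure (Q j) B) sums
      (measure (Q i) (\<Union>n. G n) * measure (Q j) B)"
    using G(1,3) by (intro sums_mult2 Q.finite_measure_UNION) (auto intro: determined_in_sets)
  ultimately show ?thesis
    using sums_unique2 by (simp add: markov[OF G(1,2) B])
qed

end

subsection \<open>Nearest neighbor paths and their first visits\<close>

definition nn_path :: "(nat \<Rightarrow> nat) \<Rightarrow> bool" where
  "nn_path x \<longleftrightarrow> (\<forall>n. x (Suc n) = Suc (x n) \<or> x n = Suc (x (Suc n)))"

definition escaping_path :: "nat \<Rightarrow> (nat \<Rightarrow> nat) \<Rightarrow> bool" where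
  "escaping_path i x \<longleftrightarrow> x 0 = i \<and> nn_path x \<and> (\<forall>j. \<exists>N. \<forall>n\<ge>N. x n \<noteq> j)"

definition first_visit :: "nat \<Rightarrow> nat \<Rightarrow> (nat \<Rightarrow> nat) set" where
  "first_visit j n = {x. x n = j \<and> (\<forall>k<n. x k \<noteq> j)}"

definition avoiding :: "nat \<Rightarrow> (nat \<Rightarrow> nat) set" where
  "avoiding l = {x. \<forall>t. x t \<noteq> l}"

lemma nn_path_between:
  assumes "nn_path x" "s \<le> t" "x s \<le> m \<and> m \<le> x t \<or> x t \<le> m \<and> m \<le> x s"
  shows "\<exists>r. s \<le> r \<and> r \<le> t \<and> x r = m"
proof -
  have step: "\<bar>int (x (Suc k)) - int (x k)\<bar> \<le> 1" for k
  proof -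
    have "x (Suc k) = Suc (x k) \<or> x k = Suc (x (Suc k))" using assms(1) by (simp add: nn_path_def)
    then show ?thesis by linarith
  qed
  from assms(3) show ?thesis
  proof
    assume "x s \<le> m \<and> m \<le> x t"
    then show ?thesis
      using nat_intermed_int_val[of s t "\<lambda>k. int (x k)" "int m"] step assms(2) by auto
  next
    assume "x t \<le> m \<and> m \<le> x s"
    then show ?thesis
      using nat_intermed_int_val[of s t "\<lambda>k. - int (x k)" "- int m"] step assms(2)
      by (auto simp: abs_minus_commute)
  qed
qed

lemma nn_path_avoiding_above:
  assumes "nn_path x" "\<And>t. t > s \<Longrightarrow> x t \<noteq> m" "x s > m" "s \<le> t"
  shows "x t > m"
proof (rule ccontr)
  assume "\<not> m < x t"
  then obtain r where "s \<le> r" "r \<le> t" "x r = m"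
    using nn_path_between[OF assms(1,4), of m] assms(3) by auto
  then show False using assms(2)[of r] assms(3) by (cases "r = s") auto
qed

lemma nn_path_below_first_visit:
  assumes "nn_path x" "x \<in> first_visit m n" "x 0 \<le> m" "k < n"
  shows "x k < m"
proof (rule ccontr)
  assume "\<not> x k < m"
  then obtain r where "r \<le> k" "x r = m"
    using nn_path_between[OF assms(1), of 0 k m] assms(3) by auto
  then show False using assms(2,4) by (auto simp: first_visit_def)
qed

lemma first_visit_exists:
  assumes "x s = m"
  shows "\<exists>n\<le>s. x \<in> first_visit m n"
proof -
  obtain n where "x n = m" "\<forall>k<n. x k \<noteq> m" using exists_least_iff[of "\<lambda>n. x n = m"] assms by blast
  moreover from this assms have "n \<le> s" by (meson not_le)
  ultimately show ?thesis by (auto simp: first_visit_def)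
qed

lemma escaping_path_eventually_above:
  assumes "escaping_path i x"
  shows "\<exists>N. \<forall>n\<ge>N. x n > m"
proof (induction m)
  case 0
  obtain N where "\<forall>n\<ge>N. x n \<noteq> 0" using assms unfolding escaping_path_def by blast
  then show ?case by auto
next
  case (Suc m)
  then obtain N where N: "\<forall>n\<ge>N. x n > m" by blast
  obtain N' where N': "\<forall>n\<ge>N'. x n \<noteq> Suc m" using assms unfolding escaping_path_def by blast
  have "x n > Suc m" if "n \<ge> max N N'" for n
    using N N' that by (metis Suc_lessI max.boundedE)
  then show ?case by blast
qed

lemma escaping_path_visits:
  assumes "escaping_path i x" "i \<le> m"
  shows "\<exists>n. x \<in> first_visit m n"
proof -
  obtain N where "\<forall>n\<ge>N. x n > m" using escaping_path_eventually_above[OF assms(1)] by blast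
  then obtain r where "x r = m"
    using nn_path_between[of x 0 N m] assms by (auto simp: escaping_path_def less_imp_le)
  then show ?thesis using first_visit_exists by blast
qed

lemma determined_first_visit: "determined n (first_visit j n)"
  by (auto simp: determined_def first_visit_def)

lemma disjoint_first_visit: "disjoint_family (first_visit j)"
  unfolding disjoint_family_on_def first_visit_def by (auto, metis linorder_neqE_nat)

lemma first_visit_subset: "first_visit j n \<subseteq> {x. x n = j}"
  by (auto simp: first_visit_def)

lemma avoiding_sets [measurable]: "avoiding l \<in> sets path_space"
proof -
  have "Measurable.pred path_space (\<lambda>x. \<forall>t. x t \<noteq> l)" by measurable
  then show ?thesis by (simp add: pred_def avoiding_def)
qed

section \<open>Almost sure escape to infinity\<close>

context walk_laws
begin

definition avoid_prob :: "nat \<Rightarrow> nat \<Rightarrow> real" where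
  "avoid_prob l k = measure (Q k) (avoiding l)"

lemma in_sets_Q: "Measurable.pred path_space P \<Longrightarrow> {x. P x} \<in> sets (Q i)"
  by (simp add: pred_def sets_Q)

lemma AE_start: "AE x in Q i. x 0 = i"
proof -
  have "measure (Q i) {x. x 0 = i} = 1"
    using cylinder_prob[of i 0 "\<lambda>_. i"] by (simp add: cylinder_def)
  moreover have "{x. x 0 = i} \<in> sets (Q i)" by (rule in_sets_Q) measurable
  ultimately show ?thesis using Q.prob_eq_1[of "{x. x 0 = i}" i] by simp
qed

lemma measure_Q_cong:
  assumes "A \<in> sets (Q i)" "B \<in> sets (Q i)" "AE x in Q i. x \<in> A \<longleftrightarrow> x \<in> B"
  shows "measure (Q i) A = measure (Q i) B"
  using assms by (intro Q.finite_measure_eq_AE)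

lemma one_step_prob: "measure (Q i) {x. x 1 = j} = step_prob p i j"
proof -
  have "measure (Q i) {x. x 1 = j} = measure (Q i) (cylinder 1 (\<lambda>k. if k = 0 then i else j))"
  proof (rule measure_Q_cong)
    show "{x. x 1 = j} \<in> sets (Q i)" by (rule in_sets_Q) measurable
    show "AE x in Q i. x \<in> {x. x 1 = j} \<longleftrightarrow> x \<in> cylinder 1 (\<lambda>k. if k = 0 then i else j)"
      using AE_start by eventually_elim (auto simp: cylinder_def le_Suc_eq)
  qed (simp add: sets_Q cylinder_sets)
  then show ?thesis by (simp add: cylinder_prob)
qed

lemma AE_nn_path: "AE x in Q i. nn_path x"
proof -
  have null: "AE x in Q i. \<not> (x n = a \<and> x (Suc n) = b)" if "\<not> (b = Suc a \<or> a = Suc b)" for n a b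
  proof -
    have m: "{x. x 1 = b} \<in> sets path_space"
      using in_sets_Q[of "\<lambda>x. x 1 = b"] by (simp add: sets_Q)
    have m2: "{x. x n = a} \<inter> {x. path_shift n x \<in> {x. x 1 = b}} \<in> sets (Q i)"
      using path_shift_vimage_sets[OF m, of n] by (intro sets.Int in_sets_Q) (simp_all add: sets_Q)
    have "measure (Q i) ({x. x n = a} \<inter> {x. path_shift n x \<in> {x. x 1 = b}}) =
        measure (Q i) {x. x n = a} * step_prob p a b"
      using markov[of n "{x. x n = a}" a "{x. x 1 = b}" i] m one_step_prob[of a b]
      by (simp add: determined_def)
    also have "step_prob p a b = 0" using that by (auto simp: step_prob_def)
    finally have "AE x in Q i. x \<notin> {x. x n = a} \<inter> {x. path_shift n x \<in> {x. x 1 = b}}"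
      using m2 by (intro AE_not_in) (simp add: null_setsI Q.emeasure_eq_measure)
    then show ?thesis by (simp add: path_shift_def)
  qed
  have "AE x in Q i. \<forall>n a b. \<not> (b = Suc a \<or> a = Suc b) \<longrightarrow> \<not> (x n = a \<and> x (Suc n) = b)"
    unfolding AE_all_countable using null by (auto simp: AE_all_countable)
  then show ?thesis by eventually_elim (auto simp: nn_path_def)
qed

lemma strong_markov_sets:
  assumes "\<And>n. determined n (G n)" "B \<in> sets path_space"
  shows "(\<Union>n. G n \<inter> {x. path_shift n x \<in> B}) \<in> sets (Q i)"
proof -
  have "G n \<inter> {x. path_shift n x \<in> B} \<in> sets (Q i)" for n
    by (intro sets.Int determined_in_sets[OF assms(1)])
      (simp only: sets_Q path_shift_vimage_sets[OF assms(2)])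
  then show ?thesis by blast
qed

text \<open>Infinitely many visits to \<open>j\<close> require one return followed again by
  infinitely many visits, so under \<open>Q j\<close> their probability \<open>v\<close> satisfies
  \<open>v \<le> r * v\<close> with return probability \<open>r < 1\<close>, which forces
  \<open>v = 0\<close>. From another start, the same event has to happen after the first visit to
  \<open>j\<close>.\<close>

lemma infinitely_often_null: "measure (Q i) {x. \<forall>N. \<exists>n\<ge>N. x n = j} = 0"
proof -
  let ?V = "{x :: nat \<Rightarrow> nat. \<forall>N. \<exists>n\<ge>N. x n = j}"
  have V: "?V \<in> sets path_space"
    using in_sets_Q[of "\<lambda>x. \<forall>N. \<exists>n\<ge>N. x n = j"] by (simp add: sets_Q)
  have shift_V: "path_shift n x \<in> ?V" if "x \<in> ?V" for n x
  proof -
    have "\<exists>k\<ge>N. x (n + k) = j" for N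
    proof -
      from that have "\<exists>k\<ge>n + N. x k = j" by simp
      then obtain k where "k \<ge> n + N" "x k = j" by blast
      then show ?thesis by (intro exI[of _ "k - n"]) simp
    qed
    then show ?thesis by (simp add: path_shift_def)
  qed
  define G where "G n = {x. n > 0 \<and> x n = j \<and> (\<forall>m. 0 < m \<and> m < n \<longrightarrow> x m \<noteq> j)}" for n :: nat
  have det: "determined n (G n)" for n by (auto simp: determined_def G_def)
  have G_Un: "(\<Union>n. G n) = {x. \<exists>m>0. x m = j}"
  proof (intro equalityI subsetI)
    fix x :: "nat \<Rightarrow> nat" assume "x \<in> {x. \<exists>m>0. x m = j}"
    then obtain m where "m > 0" "x m = j" by blast
    then obtain n where "n > 0 \<and> x n = j" "\<forall>k<n. \<not> (k > 0 \<and> x k = j)"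
      using exists_least_iff[of "\<lambda>n. n > 0 \<and> x n = j"] by blast
    then have "x \<in> G n" by (auto simp: G_def)
    then show "x \<in> (\<Union>n. G n)" by blast
  qed (auto simp: G_def)
  have "measure (Q j) ?V \<le> measure (Q j) (\<Union>n. G n \<inter> {x. path_shift n x \<in> ?V})"
  proof (rule Q.finite_measure_mono)
    show "?V \<subseteq> (\<Union>n. G n \<inter> {x. path_shift n x \<in> ?V})"
    proof
      fix x assume x: "x \<in> ?V"
      then obtain n where "n \<ge> 1" "x n = j" by blast
      then have "0 < n \<and> x n = j" by simp
      then have "x \<in> (\<Union>n. G n)" unfolding G_Un by blast
      then show "x \<in> (\<Union>n. G n \<inter> {x. path_shift n x \<in> ?V})" using shift_V[OF x] by blast
    qed
  qed (rule strong_markov_sets[OF det V])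
  also have "\<dots> = measure (Q j) (\<Union>n. G n) * measure (Q j) ?V"
    using det V by (intro strong_markov)
      (auto simp: G_def disjoint_family_on_def, metis linorder_neqE_nat)
  finally have "measure (Q j) ?V * (1 - measure (Q j) (\<Union>n. G n)) \<le> 0"
    by (simp add: algebra_simps)
  then have j: "measure (Q j) ?V = 0"
    using return_prob[of j] measure_nonneg[of "Q j" ?V] by (simp add: G_Un mult_le_0_iff)
  have "measure (Q i) ?V \<le> measure (Q i) (\<Union>n. first_visit j n \<inter> {x. path_shift n x \<in> ?V})"
  proof (rule Q.finite_measure_mono)
    show "?V \<subseteq> (\<Union>n. first_visit j n \<inter> {x. path_shift n x \<in> ?V})"
    proof
      fix x assume x: "x \<in> ?V"
      then obtain s where "x s = j" by blast
      then obtain n where "x \<in> first_visit j n" using first_visit_exists by blast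
      then show "x \<in> (\<Union>n. first_visit j n \<inter> {x. path_shift n x \<in> ?V})"
        using shift_V[OF x, of n] by blast
    qed
  qed (rule strong_markov_sets[OF determined_first_visit V])
  also have "\<dots> = measure (Q i) (\<Union>n. first_visit j n) * measure (Q j) ?V"
    by (intro strong_markov determined_first_visit first_visit_subset disjoint_first_visit V)
  finally show ?thesis using measure_nonneg[of "Q i" ?V] by (simp add: j)
qed

lemma AE_escaping: "AE x in Q i. escaping_path i x"
proof -
  have "AE x in Q i. \<not> (\<forall>N. \<exists>n\<ge>N. x n = j)" for j
  proof -
    have "{x. \<forall>N. \<exists>n\<ge>N. x n = j} \<in> sets (Q i)" by (rule in_sets_Q) measurable
    then have "AE x in Q i. x \<notin> {x. \<forall>N. \<exists>n\<ge>N. x n = j}"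
      using infinitely_often_null by (intro AE_not_in) (simp add: null_setsI Q.emeasure_eq_measure)
    then show ?thesis by simp
  qed
  then have "AE x in Q i. \<forall>j. \<not> (\<forall>N. \<exists>n\<ge>N. x n = j)"
    by (simp add: AE_all_countable)
  with AE_start AE_nn_path show ?thesis
    by eventually_elim (auto simp: escaping_path_def)
qed

lemma first_visit_prob: "i \<le> m \<Longrightarrow> measure (Q i) (\<Union>n. first_visit m n) = 1"
proof -
  assume "i \<le> m"
  have "AE x in Q i. x \<in> (\<Union>n. first_visit m n)"
    using AE_escaping[of i] by eventually_elim (use escaping_path_visits \<open>i \<le> m\<close> in blast)
  moreover have "(\<Union>n. first_visit m n) \<in> sets (Q i)"
    using determined_in_sets[OF determined_first_visit] by (intro sets.countable_UN) auto
  ultimately show ?thesis using Q.prob_eq_1 by blast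
qed

end

subsection \<open>Probabilities of avoiding a site\<close>

text \<open>The scale function of the walk based at \<open>n\<close>, at height \<open>d\<close>
  above it and normalised to 1 at height 1. The empty product at \<open>j = 0\<close> supplies the
  leading 1 of \<open>D\<close>.\<close>

definition D_partial :: "(nat \<Rightarrow> real) \<Rightarrow> nat \<Rightarrow> nat \<Rightarrow> real" where
  "D_partial p n d = (\<Sum>j<d. \<Prod>i = 1..j. U p (n + i))"

text \<open>On escaping paths this is the cutpoint property. No record time occurs in it, so it is
  plainly measurable, and it can be read off the path after its first visit to
  \<open>R + 1\<close>.\<close>

definition cut_event :: "nat \<Rightarrow> (nat \<Rightarrow> nat) set" where
  "cut_event R = {x. \<forall>s t. s < t \<longrightarrow> x s = Suc R \<longrightarrow> x t \<noteq> R}"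

definition single_visit :: "nat \<Rightarrow> (nat \<Rightarrow> nat) set" where
  "single_visit R = {x. \<forall>s t. s < t \<longrightarrow> x s = R \<longrightarrow> x t \<noteq> R}"

lemma cut_event_sets [measurable]: "cut_event R \<in> sets path_space"
proof -
  have "Measurable.pred path_space (\<lambda>x. \<forall>s t. s < t \<longrightarrow> x s = Suc R \<longrightarrow> x t \<noteq> R)" by measurable
  then show ?thesis by (simp add: pred_def cut_event_def)
qed

lemma single_visit_sets [measurable]: "single_visit R \<in> sets path_space"
proof -
  have "Measurable.pred path_space (\<lambda>x. \<forall>s t. s < t \<longrightarrow> x s = R \<longrightarrow> x t \<noteq> R)" by measurable
  then show ?thesis by (simp add: pred_def single_visit_def)
qed

text \<open>Once \<open>m\<close> is no longer visited, a nearest neighbor path cannot change sides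
  of \<open>m\<close>, so a single later time above \<open>m\<close> decides the side for all later
  times.\<close>

lemma first_visit_above:
  assumes "nn_path x" "x \<in> first_visit m n" "\<And>t. t > n \<Longrightarrow> x t \<noteq> m"
    "x t' > m" "n \<le> t'" "n \<le> t" "t \<noteq> n"
  shows "x t > m"
proof (rule ccontr)
  assume "\<not> m < x t"
  then have "x t < m" using assms(3)[of t] assms(6,7) by (metis le_neq_implies_less linorder_neqE_nat)
  show False
  proof (cases "t \<le> t'")
    case True
    then obtain r where "t \<le> r" "r \<le> t'" "x r = m"
      using nn_path_between[OF assms(1) True, of m] \<open>x t < m\<close> assms(4) by auto
    then show False using assms(3)[of r] assms(6,7) by auto
  next
    case False
    have "t' \<noteq> n" using assms(2,4) by (auto simp: first_visit_def)
    obtain r where "t' \<le> r" "r \<le> t" "x r = m"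
      using nn_path_between[OF assms(1), of t' t m] False \<open>x t < m\<close> assms(4) by auto
    then show False using assms(3)[of r] assms(5) \<open>t' \<noteq> n\<close> by auto
  qed
qed

lemma strong_cutpoint_iff_single_visit:
  assumes "escaping_path 0 x"
  shows "strong_cutpoint x R \<longleftrightarrow> x \<in> single_visit R"
proof
  assume "strong_cutpoint x R"
  then obtain k where k: "x k = R" "\<And>i. i < k \<Longrightarrow> x i < R" "\<And>i. i \<ge> k + 1 \<Longrightarrow> x i > R"
    unfolding strong_cutpoint_def by blast
  have "i = k" if "x i = R" for i
    using k(2)[of i] k(3)[of i] that by (cases i k rule: linorder_cases) auto
  then show "x \<in> single_visit R" unfolding single_visit_def by blast
next
  assume single: "x \<in> single_visit R"
  have nn: "nn_path x" and x0: "x 0 = 0" using assms by (auto simp: escaping_path_def)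
  obtain n where n: "x \<in> first_visit R n" using escaping_path_visits[OF assms, of R] by auto
  then have xn: "x n = R" by (simp add: first_visit_def)
  have no: "x t \<noteq> R" if "t > n" for t using single that xn by (auto simp: single_visit_def)
  obtain N where N: "\<forall>t\<ge>N. x t > R" using escaping_path_eventually_above[OF assms] by blast
  have "x i < R" if "i < n" for i
    using nn_path_below_first_visit[OF nn n _ that] x0 by simp
  moreover have "x i > R" if "i \<ge> n + 1" for i
    by (rule first_visit_above[OF nn n no, of "max N n"]) (use N that in auto)
  ultimately show "strong_cutpoint x R" unfolding strong_cutpoint_def using xn by blast
qed

lemma cutpoint_iff_cut_event:
  assumes "escaping_path 0 x"
  shows "cutpoint x R \<longleftrightarrow> x \<in> cut_event R"
proof
  assume "cutpoint x R"
  then obtain k where k: "x k = R" "\<And>i. i \<le> k \<Longrightarrow> x i \<le> R" "\<And>i. i \<ge> k + 1 \<Longrightarrow> x i > R"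
    unfolding cutpoint_def by blast
  have "x t \<noteq> R" if "s < t" "x s = Suc R" for s t
    using k(2)[of s] k(3)[of t] that by (cases "s \<le> k") auto
  then show "x \<in> cut_event R" unfolding cut_event_def by blast
next
  assume cut: "x \<in> cut_event R"
  have nn: "nn_path x" and x0: "x 0 = 0" using assms by (auto simp: escaping_path_def)
  obtain n where n: "x \<in> first_visit (Suc R) n" using escaping_path_visits[OF assms, of "Suc R"] by auto
  then have xn: "x n = Suc R" by (simp add: first_visit_def)
  have "n \<noteq> 0" using xn x0 by (cases n) auto
  \<comment> \<open>The cutpoint time is the one just before the first visit to
    \<open>R + 1\<close>: the path is at most \<open>R\<close> up to then, so the step into
    \<open>R + 1\<close> comes from \<open>R\<close>.\<close>
  then obtain k where k: "n = Suc k" by (cases n) auto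
  have below: "x i \<le> R" if "i \<le> k" for i
    using nn_path_below_first_visit[OF nn n, of i] x0 that k by simp
  moreover have "x k = R"
  proof -
    have "x (Suc k) = Suc (x k) \<or> x k = Suc (x (Suc k))" using nn by (simp add: nn_path_def)
    then show ?thesis using below[of k] xn k by simp
  qed
  moreover have "x i > R" if "i \<ge> k + 1" for i
    by (rule nn_path_avoiding_above[OF nn, of n])
      (use cut xn that k in \<open>auto simp: cut_event_def\<close>)
  ultimately show "cutpoint x R" unfolding cutpoint_def by blast
qed

text \<open>Before its first visit to \<open>R + 1\<close> the path lies below that site and has met
  neither \<open>k\<close> nor \<open>k + 1\<close>, so cutting off this initial piece changes
  nothing.\<close>

lemma cut_event_path_shift:
  assumes "nn_path x" "x 0 \<le> Suc R" "x \<in> first_visit (Suc R) n" "k \<ge> Suc R"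
  shows "path_shift n x \<in> cut_event k \<longleftrightarrow> x \<in> cut_event k"
proof
  assume shifted: "path_shift n x \<in> cut_event k"
  have "x t \<noteq> k" if "s < t" "x s = Suc k" for s t
  proof -
    have "n \<le> s"
    proof (rule ccontr)
      assume "\<not> n \<le> s"
      then have "x s < Suc R" by (intro nn_path_below_first_visit[OF assms(1,3,2)]) simp
      then show False using that(2) assms(4) by simp
    qed
    moreover have "s - n < t - n \<Longrightarrow> path_shift n x (s - n) = Suc k \<Longrightarrow> path_shift n x (t - n) \<noteq> k"
      using shifted by (simp add: cut_event_def)
    ultimately show ?thesis using that by (simp add: path_shift_def)
  qed
  then show "x \<in> cut_event k" unfolding cut_event_def by blast
next
  assume x: "x \<in> cut_event k"
  have "path_shift n x t \<noteq> k" if "s < t" "path_shift n x s = Suc k" for s t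
    using x that unfolding cut_event_def path_shift_def by (metis (mono_tags, lifting) mem_Collect_eq nat_add_left_cancel_less)
  then show "path_shift n x \<in> cut_event k" unfolding cut_event_def by blast
qed

lemma single_visit_path_shift:
  assumes "nn_path x" "x 0 \<le> m" "x \<in> first_visit m n" "k \<ge> m"
  shows "path_shift n x \<in> single_visit k \<longleftrightarrow> x \<in> single_visit k"
proof
  assume shifted: "path_shift n x \<in> single_visit k"
  have "x t \<noteq> k" if "s < t" "x s = k" for s t
  proof -
    have "n \<le> s"
    proof (rule ccontr)
      assume "\<not> n \<le> s"
      then have "x s < m" by (intro nn_path_below_first_visit[OF assms(1,3,2)]) simp
      then show False using that(2) assms(4) by simp
    qed
    moreover have "s - n < t - n \<Longrightarrow> path_shift n x (s - n) = k \<Longrightarrow> path_shift n x (t - n) \<noteq> k"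
      using shifted by (simp add: single_visit_def)
    ultimately show ?thesis using that by (simp add: path_shift_def)
  qed
  then show "x \<in> single_visit k" unfolding single_visit_def by blast
next
  assume x: "x \<in> single_visit k"
  have "path_shift n x t \<noteq> k" if "s < t" "path_shift n x s = k" for s t
    using x that unfolding single_visit_def path_shift_def by (metis (mono_tags, lifting) mem_Collect_eq nat_add_left_cancel_less)
  then show "path_shift n x \<in> single_visit k" unfolding single_visit_def by blast
qed

section \<open>First-step analysis of the avoiding probabilities\<close>

context walk_laws
begin

lemma avoid_prob_self: "avoid_prob l l = 0"
proof -
  have "measure (Q l) (avoiding l) = measure (Q l) {}"
  proof (rule measure_Q_cong)
    show "AE x in Q l. x \<in> avoiding l \<longleftrightarrow> x \<in> {}"
      using AE_start[of l] by eventually_elim (auto simp: avoiding_def)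
  qed (simp_all add: sets_Q avoiding_sets)
  then show ?thesis by (simp add: avoid_prob_def)
qed

lemma one_step_event:
  assumes "B \<in> sets path_space"
  shows "measure (Q k) ({x. x 1 = j} \<inter> {x. path_shift 1 x \<in> B}) = step_prob p k j * measure (Q j) B"
  using markov[of 1 "{x. x 1 = j}" j B k] assms one_step_prob[of k j] by (simp add: determined_def)

lemma one_step_sets:
  assumes "B \<in> sets path_space"
  shows "{x. x 1 = j} \<inter> {x. path_shift 1 x \<in> B} \<in> sets (Q k)"
proof -
  have "determined 1 {x. x 1 = j}" by (simp add: determined_def)
  moreover have "{x. path_shift 1 x \<in> B} \<in> sets (Q k)"
    using path_shift_vimage_sets[OF assms, of 1] by (simp only: sets_Q)
  ultimately show ?thesis by (rule sets.Int[OF determined_in_sets])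
qed

lemma avoid_prob_step:
  assumes "l < k"
  shows "avoid_prob l k = (1/2 + p k) * avoid_prob l (Suc k) + (1/2 - p k) * avoid_prob l (k - 1)"
proof -
  let ?E = "\<lambda>j. {x :: nat \<Rightarrow> nat. x 1 = j} \<inter> {x. path_shift 1 x \<in> avoiding l}"
  have "measure (Q k) (avoiding l) = measure (Q k) (?E (Suc k) \<union> ?E (k - 1))"
  proof (rule measure_Q_cong)
    show "AE x in Q k. x \<in> avoiding l \<longleftrightarrow> x \<in> ?E (Suc k) \<union> ?E (k - 1)"
      using AE_escaping[of k]
    proof eventually_elim
      case (elim x)
      then have x0: "x 0 = k" and nn: "nn_path x" by (auto simp: escaping_path_def)
      show ?case
      proof
        assume avoid: "x \<in> avoiding l"
        have "x (Suc 0) = Suc (x 0) \<or> x 0 = Suc (x (Suc 0))" using nn by (simp add: nn_path_def)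
        then show "x \<in> ?E (Suc k) \<union> ?E (k - 1)"
          using avoid x0 by (auto simp: avoiding_def path_shift_def)
      next
        assume "x \<in> ?E (Suc k) \<union> ?E (k - 1)"
        then have "x (Suc t) \<noteq> l" for t by (auto simp: avoiding_def path_shift_def)
        then have "x t \<noteq> l" for t using x0 assms by (cases t) auto
        then show "x \<in> avoiding l" by (simp add: avoiding_def)
      qed
    qed
  qed (use one_step_sets[OF avoiding_sets] in \<open>auto simp: sets_Q avoiding_sets\<close>)
  also have "\<dots> = measure (Q k) (?E (Suc k)) + measure (Q k) (?E (k - 1))"
    using one_step_sets[OF avoiding_sets] assms by (intro Q.finite_measure_Union) auto
  finally show ?thesis
    using assms unfolding avoid_prob_def
    by (simp only: one_step_event[OF avoiding_sets]) (simp add: step_prob_def)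
qed

text \<open>Brings the avoiding probabilities for all starting points \<open>k\<close> under the
  single law \<open>Q 0\<close>, where the limit in \<open>k\<close> can be taken along a decreasing
  sequence of events.\<close>

lemma revisit_prob:
  assumes "k \<noteq> l"
  shows "measure (Q 0) {x. \<exists>s t. s < t \<and> x s = k \<and> x t = l} = 1 - avoid_prob l k"
proof -
  have B: "UNIV - avoiding l \<in> sets path_space"
    using sets.compl_sets[OF avoiding_sets[of l]] by simp
  have eq: "{x. \<exists>s t. s < t \<and> x s = k \<and> x t = l} =
    (\<Union>n. first_visit k n \<inter> {x. path_shift n x \<in> UNIV - avoiding l})" (is "?L = ?R")
  proof (intro equalityI subsetI)
    fix x assume "x \<in> ?L"
    then obtain s t where st: "s < t" "x s = k" "x t = l" by blast
    obtain n where n: "n \<le> s" "x \<in> first_visit k n" using first_visit_exists[of x s k] st(2) by blast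
    have "path_shift n x (t - n) = l" using n st by (simp add: path_shift_def)
    then have "path_shift n x \<in> UNIV - avoiding l" by (auto simp: avoiding_def)
    then show "x \<in> ?R" using n(2) by blast
  next
    fix x assume "x \<in> ?R"
    then obtain n t where "x n = k" "x (n + t) = l"
      by (auto simp: first_visit_def avoiding_def path_shift_def)
    moreover from this assms have "t \<noteq> 0" by (cases t) auto
    ultimately have "n < n + t \<and> x n = k \<and> x (n + t) = l" by simp
    then show "x \<in> ?L" by blast
  qed
  have "measure (Q 0) ?L = measure (Q 0) (\<Union>n. first_visit k n) * measure (Q k) (UNIV - avoiding l)"
    unfolding eq
    by (intro strong_markov determined_first_visit first_visit_subset disjoint_first_visit B)
  also have "\<dots> = 1 - avoid_prob l k"
    using Q.prob_compl[of "avoiding l" k] avoiding_sets[of l]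
    by (simp add: first_visit_prob avoid_prob_def sets_Q)
  finally show ?thesis .
qed

text \<open>Returning from \<open>k\<close> to \<open>l\<close> for infinitely many \<open>k\<close> is impossible for an escaping path.\<close>

lemma avoid_prob_tendsto: "(\<lambda>k. avoid_prob l k) \<longlonglongrightarrow> 1"
proof -
  let ?H = "\<lambda>k. {x :: nat \<Rightarrow> nat. \<exists>s t. s < t \<and> x s = k \<and> x t = l}"
  let ?A = "\<lambda>K. (\<Union>k\<in>{K..}. ?H k)"
  have H: "?H k \<in> sets (Q i)" for k i by (rule in_sets_Q) measurable
  then have A: "?A K \<in> sets (Q i)" for K i by (intro sets.countable_UN') auto
  have "(\<lambda>K. measure (Q 0) (?A K)) \<longlonglongrightarrow> measure (Q 0) (\<Inter>K. ?A K)"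
  proof (rule Q.finite_Lim_measure_decseq)
    show "range ?A \<subseteq> sets (Q 0)" using A by blast
    show "decseq ?A" unfolding decseq_def by force
  qed
  moreover have "measure (Q 0) (\<Inter>K. ?A K) = measure (Q 0) {}"
  proof (rule measure_Q_cong)
    show "AE x in Q 0. x \<in> (\<Inter>K. ?A K) \<longleftrightarrow> x \<in> {}"
      using AE_escaping[of 0]
    proof eventually_elim
      case (elim x)
      obtain N where N: "\<forall>n\<ge>N. x n > l" using escaping_path_eventually_above[OF elim] by blast
      \<comment> \<open>From time \<open>N\<close> on the path stays above \<open>l\<close>, so a
        visit to \<open>k\<close> that precedes a visit to \<open>l\<close> happens before
        \<open>N\<close>; the sum of all positions before \<open>N\<close> is a convenient bound for
        such \<open>k\<close>.\<close>
      have "x \<notin> ?A (Suc (\<Sum>s<N. x s))"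
      proof
        assume "x \<in> ?A (Suc (\<Sum>s<N. x s))"
        then obtain s t where st: "s < t" "x s > (\<Sum>s<N. x s)" "x t = l" by auto
        then have "t < N" using N by (metis linorder_not_less nat_neq_iff)
        then have "x s \<le> (\<Sum>s<N. x s)" using st(1) by (intro member_le_sum) auto
        then show False using st(2) by simp
      qed
      then show ?case by blast
    qed
  qed (use A in auto)
  ultimately have lim: "(\<lambda>K. measure (Q 0) (?A K)) \<longlonglongrightarrow> 0" by simp
  have le: "1 - avoid_prob l k \<le> measure (Q 0) (?A k)" if "k > l" for k
  proof -
    have "1 - avoid_prob l k = measure (Q 0) (?H k)" using revisit_prob[of k l] that by simp
    also have "\<dots> \<le> measure (Q 0) (?A k)" using A by (intro Q.finite_measure_mono) auto
    finally show ?thesis .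
  qed
  have "(\<lambda>k. 1 - avoid_prob l k) \<longlonglongrightarrow> 0"
  proof (rule tendsto_sandwich[OF _ _ tendsto_const lim])
    show "\<forall>\<^sub>F k in sequentially. 0 \<le> 1 - avoid_prob l k"
      by (simp add: avoid_prob_def)
    show "\<forall>\<^sub>F k in sequentially. 1 - avoid_prob l k \<le> measure (Q 0) (?A k)"
      using eventually_gt_at_top[of l] by eventually_elim (rule le)
  qed
  from tendsto_diff[OF tendsto_const[of 1] this] show ?thesis by simp
qed

text \<open>By the one-step equation, consecutive increments of \<open>avoid_prob l\<close> have
  ratio \<open>U p k\<close>. The first increment is \<open>avoid_prob l (Suc l)\<close>, as the
  value at \<open>l\<close> is 0, and the increments add up to the partial sums of \<open>D\<close>.
  The equation is of second order, whence the strong induction with two base cases.\<close>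

lemma avoid_prob_eq: "avoid_prob l (l + d) = avoid_prob l (Suc l) * D_partial p l d"
proof (induction d rule: less_induct)
  case (less d)
  consider "d = 0" | "d = 1" | e where "d = Suc (Suc e)" by (metis One_nat_def old.nat.exhaust)
  then show ?case
  proof cases
    case 3
    define k where "k = l + Suc e"
    have pk: "0 \<le> p k" "p k < 1/2" using p_range[of k] by (auto simp: k_def)
    have "(1/2 + p k) * (avoid_prob l (Suc k) - avoid_prob l k) =
        (1/2 - p k) * (avoid_prob l k - avoid_prob l (k - 1))"
      using avoid_prob_step[of l k] by (simp add: k_def algebra_simps)
    then have "avoid_prob l (Suc k) - avoid_prob l k = U p k * (avoid_prob l k - avoid_prob l (k - 1))"
      using pk by (simp add: U_def field_simps)
    also have "avoid_prob l k - avoid_prob l (k - 1) = avoid_prob l (Suc l) * (\<Prod>i = 1..e. U p (l + i))"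
      using less[of "Suc e"] less[of e] 3 by (simp add: k_def D_partial_def algebra_simps)
    also have "U p k * (avoid_prob l (Suc l) * (\<Prod>i = 1..e. U p (l + i))) =
        avoid_prob l (Suc l) * (\<Prod>i = 1..Suc e. U p (l + i))"
      by (simp add: k_def)
    finally show ?thesis
      using less[of "Suc e"] 3 by (simp add: k_def D_partial_def algebra_simps)
  qed (simp_all add: avoid_prob_self D_partial_def)
qed

text \<open>Let \<open>d\<close> tend to infinity in \<open>avoid_prob_eq\<close>. The left side
  tends to 1, which excludes a vanishing factor and makes the partial sums converge to its
  reciprocal. This is where transience becomes finiteness of \<open>D\<close>.\<close>

lemma avoid_prob_pos: "avoid_prob l (Suc l) > 0"
  and D_sums: "(\<lambda>j. \<Prod>i = 1..j. U p (l + i)) sums (1 / avoid_prob l (Suc l))"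
proof -
  have lim: "(\<lambda>d. avoid_prob l (Suc l) * D_partial p l d) \<longlonglongrightarrow> 1"
    using LIMSEQ_ignore_initial_segment[OF avoid_prob_tendsto, of l l]
    by (simp add: avoid_prob_eq[symmetric] add.commute)
  have "avoid_prob l (Suc l) \<noteq> 0"
  proof
    assume "avoid_prob l (Suc l) = 0"
    then have "(\<lambda>d. 0 :: real) \<longlonglongrightarrow> 1" using lim by simp
    then show False using LIMSEQ_unique[OF tendsto_const] by fastforce
  qed
  then show pos: "avoid_prob l (Suc l) > 0"
    using measure_nonneg[of "Q (Suc l)" "avoiding l"] unfolding avoid_prob_def by linarith
  have "(\<lambda>d. D_partial p l d) \<longlonglongrightarrow> 1 / avoid_prob l (Suc l)"
    using tendsto_divide[OF lim tendsto_const[of "avoid_prob l (Suc l)"]] pos by simp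
  then show "(\<lambda>j. \<Prod>i = 1..j. U p (l + i)) sums (1 / avoid_prob l (Suc l))"
    by (simp add: sums_def D_partial_def)
qed

lemma summable_D: "summable (\<lambda>j. \<Prod>i = 1..Suc j. U p (l + i))"
  using sums_summable[OF D_sums[of l]] by (subst summable_Suc_iff)

lemma avoid_prob_D: "avoid_prob l (Suc l) = 1 / D p l"
proof -
  have "D p l = 1 / avoid_prob l (Suc l)"
    using suminf_split_head[OF sums_summable[OF D_sums[of l]]] sums_unique[OF D_sums[of l]]
    by (simp add: D_def)
  then show ?thesis by simp
qed

lemma D_pos: "D p l > 0"
  using avoid_prob_pos[of l] by (simp add: avoid_prob_D)

lemma D_ge_1: "D p l \<ge> 1"
proof -
  have "1 / D p l \<le> 1"
    using Q.prob_le_1[of "Suc l" "avoiding l"] by (simp add: avoid_prob_D[symmetric] avoid_prob_def)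
  then show ?thesis using D_pos[of l] by (simp add: divide_le_eq)
qed

end

section \<open>Cutpoints seen from a first visit, and their renewal structure\<close>

lemma path_shift_avoidingD:
  assumes "path_shift n x \<in> avoiding R" "n \<le> t"
  shows "x t \<noteq> R"
proof -
  have "path_shift n x (t - n) \<noteq> R" using assms(1) unfolding avoiding_def by blast
  then show ?thesis using assms(2) by (simp add: path_shift_def)
qed

lemma avoiding_iff_cut_event:
  assumes n: "x \<in> first_visit (Suc R) n"
  shows "path_shift n x \<in> avoiding R \<longleftrightarrow> x \<in> cut_event R"
proof
  assume avoid: "path_shift n x \<in> avoiding R"
  have "x t \<noteq> R" if "s < t" "x s = Suc R" for s t
  proof -
    have "n \<le> s" using n that(2) unfolding first_visit_def by (auto simp: not_less[symmetric])
    then show ?thesis using path_shift_avoidingD[OF avoid] that by simp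
  qed
  then show "x \<in> cut_event R" unfolding cut_event_def by blast
next
  assume cut: "x \<in> cut_event R"
  have xn: "x n = Suc R" using n by (simp add: first_visit_def)
  have "x (n + t) \<noteq> R" for t
  proof (cases "t = 0")
    case False
    then have "n < n + t" by simp
    then show ?thesis using cut xn unfolding cut_event_def by blast
  qed (simp add: xn)
  then show "path_shift n x \<in> avoiding R" by (simp add: avoiding_def path_shift_def)
qed

definition after_first_visit :: "nat \<Rightarrow> (nat \<Rightarrow> nat) set \<Rightarrow> (nat \<Rightarrow> nat) set" where
  "after_first_visit m B = (\<Union>n. first_visit m n \<inter> {x. path_shift n x \<in> B})"

context walk_laws
begin

lemma after_first_visit_sets:
  "B \<in> sets path_space \<Longrightarrow> after_first_visit m B \<in> sets (Q i)"
  unfolding after_first_visit_def by (rule strong_markov_sets[OF determined_first_visit])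

lemma after_first_visit_prob:
  assumes "B \<in> sets path_space"
  shows "measure (Q 0) (after_first_visit m B) = measure (Q m) B"
proof -
  have "measure (Q 0) (after_first_visit m B) = measure (Q 0) (\<Union>n. first_visit m n) * measure (Q m) B"
    unfolding after_first_visit_def
    by (intro strong_markov determined_first_visit first_visit_subset disjoint_first_visit assms)
  then show ?thesis by (simp add: first_visit_prob)
qed

lemma after_first_visit_iff:
  assumes "escaping_path i x" "i \<le> m" "\<And>n. x \<in> first_visit m n \<Longrightarrow> path_shift n x \<in> B \<longleftrightarrow> P"
  shows "x \<in> after_first_visit m B \<longleftrightarrow> P"
proof -
  obtain n where "x \<in> first_visit m n" using escaping_path_visits[OF assms(1,2)] by blast
  then show ?thesis using assms(3) unfolding after_first_visit_def by blast
qed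

lemma cut_event_prob: "measure (Q 0) (cut_event R) = 1 / D p R"
proof -
  have "measure (Q 0) (cut_event R) = measure (Q 0) (after_first_visit (Suc R) (avoiding R))"
  proof (rule measure_Q_cong)
    show "AE x in Q 0. x \<in> cut_event R \<longleftrightarrow> x \<in> after_first_visit (Suc R) (avoiding R)"
      using AE_escaping[of 0]
    proof eventually_elim
      case (elim x)
      from after_first_visit_iff[OF elim _ avoiding_iff_cut_event] show ?case by simp
    qed
  qed (simp_all only: sets_Q cut_event_sets after_first_visit_sets[OF avoiding_sets, unfolded sets_Q])
  also have "\<dots> = 1 / D p R"
    by (simp add: after_first_visit_prob avoiding_sets avoid_prob_D[symmetric] avoid_prob_def)
  finally show ?thesis .
qed

text \<open>After the first visit to \<open>R\<close> it suffices to step up, which has probability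
  at least 1/2 because \<open>p\<close> is nonnegative, and then to avoid \<open>R\<close> from
  \<open>R + 1\<close>. Hence the loss of a factor 2 against cutpoints.\<close>

lemma single_visit_prob_ge: "measure (Q 0) (single_visit R) \<ge> 1 / (2 * D p R)"
proof -
  let ?B = "{x :: nat \<Rightarrow> nat. \<forall>t>0. x t \<noteq> R}"
  have B: "?B \<in> sets path_space"
    using in_sets_Q[of "\<lambda>x. \<forall>t>0. x t \<noteq> R"] by (simp add: sets_Q)
  have "measure (Q 0) (single_visit R) = measure (Q 0) (after_first_visit R ?B)"
  proof (rule measure_Q_cong)
    show "AE x in Q 0. x \<in> single_visit R \<longleftrightarrow> x \<in> after_first_visit R ?B"
      using AE_escaping[of 0]
    proof eventually_elim
      case (elim x)
      have "path_shift n x \<in> ?B \<longleftrightarrow> x \<in> single_visit R" if n: "x \<in> first_visit R n" for n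
      proof
        assume avoid: "path_shift n x \<in> ?B"
        have "x t \<noteq> R" if "s < t" "x s = R" for s t
        proof -
          have "n \<le> s" using n that(2) unfolding first_visit_def by (auto simp: not_less[symmetric])
          then have "path_shift n x (t - n) = x t" "t - n > 0" using that by (simp_all add: path_shift_def)
          then show ?thesis using avoid by auto
        qed
        then show "x \<in> single_visit R" unfolding single_visit_def by blast
      next
        assume cut: "x \<in> single_visit R"
        have xn: "x n = R" using n by (simp add: first_visit_def)
        have "x (n + t) \<noteq> R" if "t > 0" for t
          using cut xn less_add_same_cancel1[of n t] that unfolding single_visit_def by blast
        then show "path_shift n x \<in> ?B" by (simp add: path_shift_def)
      qed
      from after_first_visit_iff[OF elim _ this] show ?case by simp
    qed
  next
    show "after_first_visit R ?B \<in> sets (Q 0)" using B by (rule after_first_visit_sets)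
  qed (simp only: sets_Q single_visit_sets)
  also have "\<dots> = measure (Q R) ?B" using B by (rule after_first_visit_prob)
  also have "\<dots> \<ge> measure (Q R) ({x. x 1 = Suc R} \<inter> {x. path_shift 1 x \<in> avoiding R})"
  proof (rule Q.finite_measure_mono)
    show "{x. x 1 = Suc R} \<inter> {x. path_shift 1 x \<in> avoiding R} \<subseteq> ?B"
    proof
      fix x assume "x \<in> {x. x 1 = Suc R} \<inter> {x. path_shift 1 x \<in> avoiding R}"
      then have x: "x (Suc k) \<noteq> R" for k by (auto simp: avoiding_def path_shift_def)
      have "x t \<noteq> R" if "t > 0" for t using x[of "t - 1"] that by simp
      then show "x \<in> ?B" by blast
    qed
  qed (simp only: sets_Q B)
  also have "measure (Q R) ({x. x 1 = Suc R} \<inter> {x. path_shift 1 x \<in> avoiding R}) =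
      step_prob p R (Suc R) * avoid_prob R (Suc R)"
    unfolding avoid_prob_def by (rule one_step_event[OF avoiding_sets])
  finally have "measure (Q 0) (single_visit R) \<ge> step_prob p R (Suc R) * avoid_prob R (Suc R)" .
  moreover have "step_prob p R (Suc R) \<ge> 1/2"
    using p_range[of R] by (auto simp: step_prob_def)
  then have "step_prob p R (Suc R) * avoid_prob R (Suc R) \<ge> 1/2 * avoid_prob R (Suc R)"
    using avoid_prob_pos[of R] by (intro mult_right_mono) auto
  ultimately show ?thesis by (simp add: avoid_prob_D)
qed

text \<open>The renewal identity. \<open>G n\<close> is the part of the cut condition at
  \<open>R'\<close> that is settled by time \<open>n\<close>, the first visit to
  \<open>R + 1\<close>. Given this past, the future is a fresh walk from \<open>R + 1\<close>, so
  the past has the same probability \<open>1 / D_partial p R' (Suc R - R')\<close> whatever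
  \<open>B\<close> is.\<close>

lemma cut_event_after_first_visit_prob:
  assumes R: "R' < R" and B: "B \<in> sets path_space" "B \<subseteq> avoiding R"
  shows "measure (Q 0) (cut_event R' \<inter> after_first_visit (Suc R) B) =
    measure (Q 0) (after_first_visit (Suc R) B) / D_partial p R' (Suc R - R')"
proof -
  define G where "G n = first_visit (Suc R) n \<inter> {x. \<forall>s t. s < t \<longrightarrow> t \<le> n \<longrightarrow> x s = Suc R' \<longrightarrow> x t \<noteq> R'}" for n
  have det: "determined n (G n)" for n
    unfolding determined_def
  proof (intro allI impI)
    fix x y assume eq: "\<forall>k\<le>n. x k = y k" and x: "x \<in> G n"
    have y: "y k = x k" if "k \<le> n" for k using eq that by simp
    show "y \<in> G n" using x by (simp add: G_def first_visit_def y)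
  qed
  have sub: "G n \<subseteq> {x. x n = Suc R}" for n by (auto simp: G_def first_visit_def)
  have disj: "disjoint_family G"
    using disjoint_first_visit[of "Suc R"] unfolding disjoint_family_on_def G_def by blast
  have G_prob: "measure (Q 0) (\<Union>n. G n \<inter> {x. path_shift n x \<in> C}) =
      measure (Q 0) (\<Union>n. G n) * measure (Q (Suc R)) C" if "C \<in> sets path_space" for C
    using det sub disj that by (rule strong_markov)
  \<comment> \<open>Here the future is only asked to avoid \<open>R'\<close>. The total probability
    \<open>1 / D p R'\<close> is already known, so this factorisation determines the probability of
    the past.\<close>
  have cut_avoid: "measure (Q 0) (cut_event R') = measure (Q 0) (\<Union>n. G n \<inter> {x. path_shift n x \<in> avoiding R'})"
  proof (rule measure_Q_cong)
    show "AE x in Q 0. x \<in> cut_event R' \<longleftrightarrow> x \<in> (\<Union>n. G n \<inter> {x. path_shift n x \<in> avoiding R'})"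
      using AE_escaping[of 0]
    proof eventually_elim
      case (elim x)
      then have nn: "nn_path x" and x0: "x 0 = 0" by (auto simp: escaping_path_def)
      show ?case
      proof
        assume cut: "x \<in> cut_event R'"
        obtain n where n: "x \<in> first_visit (Suc R) n"
          using escaping_path_visits[OF elim, of "Suc R"] by blast
        then have xn: "x n = Suc R" by (simp add: first_visit_def)
        obtain s where s: "s \<le> n" "x s = Suc R'"
          using nn_path_between[OF nn, of 0 n "Suc R'"] x0 xn R by auto
        have "s \<noteq> n" using s xn R by auto
        then have "s < n + t" for t using s(1) by simp
        then have "x (n + t) \<noteq> R'" for t using cut s(2) unfolding cut_event_def by blast
        then have "path_shift n x \<in> avoiding R'" by (simp add: avoiding_def path_shift_def)
        moreover have "x \<in> G n" using cut n by (auto simp: G_def cut_event_def)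
        ultimately show "x \<in> (\<Union>n. G n \<inter> {x. path_shift n x \<in> avoiding R'})" by blast
      next
        assume "x \<in> (\<Union>n. G n \<inter> {x. path_shift n x \<in> avoiding R'})"
        then obtain n where G: "x \<in> G n" and avoid: "path_shift n x \<in> avoiding R'" by blast
        have "x t \<noteq> R'" if "s < t" "x s = Suc R'" for s t
        proof (cases "t \<le> n")
          case True then show ?thesis using G that by (auto simp: G_def)
        next
          case False
          then show ?thesis using path_shift_avoidingD[OF avoid] by simp
        qed
        then show "x \<in> cut_event R'" unfolding cut_event_def by blast
      qed
    qed
  next
    show "(\<Union>n. G n \<inter> {x. path_shift n x \<in> avoiding R'}) \<in> sets (Q 0)"
      by (rule strong_markov_sets[OF det avoiding_sets])
  qed (simp only: sets_Q cut_event_sets)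
  have "1 / D p R' = measure (Q 0) (\<Union>n. G n) * avoid_prob R' (Suc R)"
    using cut_avoid G_prob[OF avoiding_sets] cut_event_prob by (simp add: avoid_prob_def)
  also have "avoid_prob R' (Suc R) = D_partial p R' (Suc R - R') / D p R'"
    using avoid_prob_eq[of R' "Suc R - R'"] R by (simp add: avoid_prob_D)
  finally have G_Un: "measure (Q 0) (\<Union>n. G n) * D_partial p R' (Suc R - R') = 1"
    using D_pos[of R'] by (simp add: field_simps)
  have "cut_event R' \<inter> after_first_visit (Suc R) B \<in> sets (Q 0)"
    using after_first_visit_sets[OF B(1)] by (intro sets.Int) (simp_all only: sets_Q cut_event_sets)
  then have "measure (Q 0) (cut_event R' \<inter> after_first_visit (Suc R) B) =
    measure (Q 0) (\<Union>n. G n \<inter> {x. path_shift n x \<in> B})"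
  proof (rule measure_Q_cong)
    show "AE x in Q 0. x \<in> cut_event R' \<inter> after_first_visit (Suc R) B \<longleftrightarrow>
        x \<in> (\<Union>n. G n \<inter> {x. path_shift n x \<in> B})"
      using AE_nn_path[of 0]
    proof eventually_elim
      case (elim x)
      show ?case
      proof
        assume "x \<in> cut_event R' \<inter> after_first_visit (Suc R) B"
        then show "x \<in> (\<Union>n. G n \<inter> {x. path_shift n x \<in> B})"
          unfolding after_first_visit_def G_def cut_event_def by blast
      next
        assume "x \<in> (\<Union>n. G n \<inter> {x. path_shift n x \<in> B})"
        then obtain n where G: "x \<in> G n" and n: "path_shift n x \<in> B" by blast
        have xn: "x n = Suc R" using G sub by blast
        \<comment> \<open>A future in \<open>B\<close> avoids \<open>R\<close>, hence stays above it
          and cannot touch \<open>R' < R\<close>: the cut condition at \<open>R'\<close> after time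
          \<open>n\<close> holds by itself.\<close>
        have no: "x t \<noteq> R" if "t > n" for t
          using path_shift_avoidingD[of n x R t] n B(2) that by auto
        have "x t \<noteq> R'" if "s < t" "x s = Suc R'" for s t
        proof (cases "t \<le> n")
          case True then show ?thesis using G that by (auto simp: G_def)
        next
          case False
          then have "x t > R" using nn_path_avoiding_above[OF elim, of n R t] no xn by simp
          then show ?thesis using R by simp
        qed
        then have "x \<in> cut_event R'" unfolding cut_event_def by blast
        then show "x \<in> cut_event R' \<inter> after_first_visit (Suc R) B"
          using G n unfolding after_first_visit_def G_def by blast
      qed
    qed
  qed (rule strong_markov_sets[OF det B(1)])
  also have "\<dots> = measure (Q 0) (\<Union>n. G n) * measure (Q 0) (after_first_visit (Suc R) B)"
    by (simp add: G_prob[OF B(1)] after_first_visit_prob[OF B(1)])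
  finally have "measure (Q 0) (cut_event R' \<inter> after_first_visit (Suc R) B) * D_partial p R' (Suc R - R') =
      measure (Q 0) (after_first_visit (Suc R) B) * (measure (Q 0) (\<Union>n. G n) * D_partial p R' (Suc R - R'))"
    by (simp only: mult_ac)
  moreover have "D_partial p R' (Suc R - R') \<noteq> 0" using G_Un by auto
  ultimately show ?thesis by (simp only: G_Un mult_1_right eq_divide_eq)  simp
qed

end

subsection \<open>Finitely many cutpoints\<close>

lemma nn_path_le: "nn_path x \<Longrightarrow> x t \<le> x 0 + t"
proof (induction t)
  case (Suc t)
  then have "x (Suc t) = Suc (x t) \<or> x t = Suc (x (Suc t))" by (simp add: nn_path_def)
  with Suc show ?case by auto
qed simp

definition infinitely_many_single :: "(nat \<Rightarrow> nat) set" where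
  "infinitely_many_single = {x. \<forall>N. \<exists>R\<ge>N. x \<in> single_visit R}"

lemma infinitely_many_single_sets [measurable]: "infinitely_many_single \<in> sets path_space"
proof -
  have "infinitely_many_single = (\<Inter>N. \<Union>R\<in>{N..}. single_visit R)"
    by (auto simp: infinitely_many_single_def)
  also have "\<dots> \<in> sets path_space"
    by (intro sets.countable_INT' sets.countable_UN') (auto simp: single_visit_sets)
  finally show ?thesis .
qed

text \<open>The sum starts at 2 because a site at distance 1 below the last cutpoint already has the
  bound 1/2.\<close>

lemma harmonic_tail_ge: "ln (real w + 2) - ln 2 \<le> (\<Sum>d = 2..Suc w. 1 / real d)"
proof (induction w)
  case (Suc w)
  have "ln (real w + 3) - ln (real w + 2) = ln (1 + 1 / (real w + 2))"
  proof -
    have "1 + 1 / (real w + 2) = (real w + 3) / (real w + 2)" by (simp add: field_simps)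
    then show ?thesis by (simp add: ln_div)
  qed
  also have "\<dots> \<le> 1 / (real w + 2)" by (rule ln_add_one_self_le_self) simp
  finally show ?case using Suc by (simp add: algebra_simps)
qed simp

lemma summable_dyadic_blocks:
  fixes a :: "nat \<Rightarrow> real"
  assumes "summable a" "\<And>n. a n \<ge> 0"
  shows "summable (\<lambda>k. \<Sum>n = 2^k..<2^Suc k. a n)"
proof (rule summableI_nonneg_bounded)
  fix K
  have "(\<Sum>k<K. \<Sum>n = 2^k..<2^Suc k. a n) = (\<Sum>n = 1..<2^K. a n)"
  proof (induction K)
    case (Suc K)
    have "(\<Sum>n = 1..<2^K. a n) + (\<Sum>n = 2^K..<2^Suc K. a n) = (\<Sum>n = 1..<2^Suc K. a n)"
      by (rule sum.atLeastLessThan_concat) simp_all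
    with Suc show ?case by simp
  qed simp
  also have "\<dots> \<le> suminf a" using assms by (intro sum_le_suminf) auto
  finally show "(\<Sum>k<K. \<Sum>n = 2^k..<2^Suc k. a n) \<le> suminf a" .
qed (intro sum_nonneg assms)

section \<open>A zero-one law for the sites visited once\<close>

context walk_laws
begin

text \<open>Whether infinitely many sites are visited only once is decided by the path after its first
  visit to \<open>n + 1\<close>, which comes later than time \<open>n\<close>.\<close>

lemma infinitely_many_single_indep:
  assumes A: "determined n A"
  shows "measure (Q 0) (A \<inter> infinitely_many_single) =
    measure (Q 0) A * measure (Q 0) infinitely_many_single"
proof -
  let ?E = "infinitely_many_single"
  have eq: "measure (Q 0) (A \<inter> ?E) = measure (Q 0) A * measure (Q (Suc n)) ?E" if A: "determined n A" for A
  proof -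
    \<comment> \<open>Leaving \<open>G t\<close> empty for \<open>t < n\<close> makes it determined
      by time \<open>t\<close>. Almost nothing is lost, since with unit steps from 0 the site
      \<open>n + 1\<close> is reached only after time \<open>n\<close>.\<close>
    define G where "G t = (if n \<le> t then A \<inter> first_visit (Suc n) t else {})" for t
    have det: "determined t (G t)" for t
    proof (cases "n \<le> t")
      case True
      have "y \<in> A" if "\<forall>k\<le>t. x k = y k" "x \<in> A" for x y
      proof -
        have "\<forall>k\<le>n. x k = y k" using that(1) True by simp
        then show ?thesis using A that(2) unfolding determined_def by blast
      qed
      then have "determined t A" unfolding determined_def by blast
      then show ?thesis
        using determined_first_visit[of t "Suc n"] True unfolding G_def determined_def by auto
    qed (simp add: G_def determined_def)
    have sub: "G t \<subseteq> {x. x t = Suc n}" for t by (auto simp: G_def first_visit_def)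
    have disj: "disjoint_family G"
      using disjoint_first_visit[of "Suc n"] unfolding disjoint_family_on_def G_def by auto
    have G_iff: "x \<in> G t \<longleftrightarrow> x \<in> A \<and> x \<in> first_visit (Suc n) t" if "escaping_path 0 x" for x t
    proof -
      have "n \<le> t" if "x \<in> first_visit (Suc n) t"
        using nn_path_le[of x t] that \<open>escaping_path 0 x\<close> by (auto simp: escaping_path_def first_visit_def)
      then show ?thesis by (auto simp: G_def)
    qed
    have inv: "path_shift t x \<in> ?E \<longleftrightarrow> x \<in> ?E" if "escaping_path 0 x" "x \<in> first_visit (Suc n) t" for x t
    proof -
      have nn: "nn_path x" "x 0 \<le> Suc n" using that(1) by (auto simp: escaping_path_def)
      have iff: "path_shift t x \<in> single_visit R \<longleftrightarrow> x \<in> single_visit R" if "R \<ge> Suc n" for R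
        by (rule single_visit_path_shift[OF nn \<open>x \<in> first_visit (Suc n) t\<close> that])
      have tail: "y \<in> ?E \<longleftrightarrow> (\<forall>N\<ge>Suc n. \<exists>R\<ge>N. y \<in> single_visit R)" for y
        unfolding infinitely_many_single_def by (auto intro: le_trans) (metis le_trans nat_le_linear)
      have "(\<forall>N\<ge>Suc n. \<exists>R\<ge>N. path_shift t x \<in> single_visit R) \<longleftrightarrow>
          (\<forall>N\<ge>Suc n. \<exists>R\<ge>N. x \<in> single_visit R)"
        using iff by (meson le_trans)
      then show ?thesis unfolding tail .
    qed
    have E: "?E \<in> sets (Q 0)" by (simp only: sets_Q infinitely_many_single_sets)
    have "measure (Q 0) (A \<inter> ?E) = measure (Q 0) (\<Union>t. G t \<inter> {x. path_shift t x \<in> ?E})"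
    proof (rule measure_Q_cong)
      show "A \<inter> ?E \<in> sets (Q 0)" by (rule sets.Int[OF determined_in_sets[OF A] E])
      show "(\<Union>t. G t \<inter> {x. path_shift t x \<in> ?E}) \<in> sets (Q 0)"
        by (rule strong_markov_sets[OF det infinitely_many_single_sets])
      show "AE x in Q 0. x \<in> A \<inter> ?E \<longleftrightarrow> x \<in> (\<Union>t. G t \<inter> {x. path_shift t x \<in> ?E})"
        using AE_escaping[of 0]
      proof eventually_elim
        case (elim x)
        obtain t where "x \<in> first_visit (Suc n) t"
          using escaping_path_visits[OF elim, of "Suc n"] by blast
        then show ?case using G_iff[OF elim] inv[OF elim] by blast
      qed
    qed
    also have "\<dots> = measure (Q 0) (\<Union>t. G t) * measure (Q (Suc n)) ?E"
      using det sub disj infinitely_many_single_sets by (rule strong_markov)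
    also have "measure (Q 0) (\<Union>t. G t) = measure (Q 0) A"
    proof (rule measure_Q_cong)
      show "A \<in> sets (Q 0)" using A by (rule determined_in_sets)
      show "(\<Union>t. G t) \<in> sets (Q 0)" using determined_in_sets[OF det] by (intro sets.countable_UN) auto
      show "AE x in Q 0. x \<in> (\<Union>t. G t) \<longleftrightarrow> x \<in> A"
        using AE_escaping[of 0]
      proof eventually_elim
        case (elim x)
        obtain t where "x \<in> first_visit (Suc n) t"
          using escaping_path_visits[OF elim, of "Suc n"] by blast
        then show ?case using G_iff[OF elim] by blast
      qed
    qed
    finally show ?thesis .
  qed
  \<comment> \<open>The choice \<open>A = UNIV\<close> shows that the factor under
    \<open>Q (Suc n)\<close> equals the probability under \<open>Q 0\<close>.\<close>
  have "determined n UNIV" by (simp add: determined_def)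
  from eq[OF this] eq[OF A] show ?thesis by (simp add: Q.prob_space[of 0, simplified])
qed

text \<open>Independence of all cylinders extends to all events, because restricting
  \<open>Q 0\<close> to the event and scaling \<open>Q 0\<close> by its probability give measures
  that agree on cylinders. Thus the event is independent of itself and its probability equals its
  own square.\<close>

lemma infinitely_many_single_0_1:
  "measure (Q 0) infinitely_many_single = 0 \<or> measure (Q 0) infinitely_many_single = 1"
proof -
  let ?E = "infinitely_many_single"
  define N1 where "N1 = density (Q 0) (indicator ?E)"
  define N2 where "N2 = scale_measure (emeasure (Q 0) ?E) (Q 0)"
  have E: "?E \<in> sets (Q 0)" by (simp only: sets_Q infinitely_many_single_sets)
  have N1: "emeasure N1 B = ennreal (measure (Q 0) (?E \<inter> B))" if "B \<in> sets (Q 0)" for B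
    unfolding N1_def using E that by (simp add: emeasure_restricted Q.emeasure_eq_measure)
  have N2: "emeasure N2 B = ennreal (measure (Q 0) ?E * measure (Q 0) B)" for B
    unfolding N2_def by (simp add: Q.emeasure_eq_measure ennreal_mult)
  have "N1 = N2"
  proof (rule measure_eqI_cylinders)
    show "sets N1 = sets path_space" "sets N2 = sets path_space"
      by (simp_all add: N1_def N2_def sets_Q)
    show "finite_measure N1"
      by (rule finite_measureI) (use N1[of UNIV] sets.top[of "Q 0"] in \<open>simp add: N1_def\<close>)
    show "emeasure N1 (cylinder n y) = emeasure N2 (cylinder n y)" for n y
    proof -
      have "determined n (cylinder n y)" by (simp add: determined_def cylinder_def)
      from infinitely_many_single_indep[OF this] show ?thesis
        by (simp add: N1 N2 sets_Q cylinder_sets Int_commute mult.commute)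
    qed
  qed
  then have "ennreal (measure (Q 0) ?E) = ennreal (measure (Q 0) ?E * measure (Q 0) ?E)"
    using N1[OF E] N2[of ?E] by simp
  then have "measure (Q 0) ?E = measure (Q 0) ?E * measure (Q 0) ?E" by simp
  then show ?thesis by simp
qed

section \<open>Cutpoints in dyadic blocks\<close>

lemma U_bounds:
  assumes "i \<ge> 1"
  shows "0 < U p i" "U p i \<le> 1"
  using p_range[OF assms] by (auto simp: U_def field_simps)

lemma D_partial_le: "D_partial p l d \<le> real d"
proof -
  have "(\<Prod>i = 1..j. U p (l + i)) \<le> 1" for j
    using U_bounds by (intro prod_le_1) (auto intro: less_imp_le)
  then have "D_partial p l d \<le> (\<Sum>j<d. 1)" unfolding D_partial_def by (intro sum_mono)
  then show ?thesis by simp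
qed

lemma D_partial_ge_1: "d > 0 \<Longrightarrow> D_partial p l d \<ge> 1"
proof -
  assume "d > 0"
  then obtain e where d: "d = Suc e" by (cases d) auto
  have "(\<Prod>i = 1..j. U p (l + i)) \<ge> 0" for j
    using U_bounds by (intro prod_nonneg) (auto intro: less_imp_le)
  then have "(\<Sum>j<e. \<Prod>i = 1..Suc j. U p (l + i)) \<ge> 0" by (intro sum_nonneg)
  then show ?thesis
    unfolding D_partial_def d sum.lessThan_Suc_shift by simp
qed

text \<open>Looking back from the last cutpoint of a block, the site at distance \<open>d\<close> below it is a
  cutpoint with conditional probability at least \<open>1 / (d + 1)\<close>, so a block that contains a
  cutpoint has on average logarithmically many of them just before its last one.\<close>

lemma cut_block_prob:
  assumes "w \<le> a"
  shows "measure (Q 0) (\<Union>R\<in>{a..<b}. cut_event R) * (\<Sum>d = 2..Suc w. 1 / real d) \<le>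
    (\<Sum>R = a - w..<b. 1 / D p R)"
proof -
  \<comment> \<open>Decomposition by the last cut below \<open>b\<close>: the renewal identity looks
    backwards from a cut whose future is prescribed.\<close>
  define L where "L R = cut_event R - (\<Union>k\<in>{R<..<b}. cut_event k)" for R
  have cut: "cut_event R \<in> sets (Q 0)" for R by (simp only: sets_Q cut_event_sets)
  have L: "L R \<in> sets (Q 0)" for R
    unfolding L_def using cut by (intro sets.Diff sets.finite_UN) auto
  have disj: "disjoint_family_on L {a..<b}"
    unfolding disjoint_family_on_def
  proof (intro ballI impI)
    fix m n assume "m \<in> {a..<b}" "n \<in> {a..<b}" "m \<noteq> n"
    then show "L m \<inter> L n = {}" unfolding L_def by (cases m n rule: linorder_cases) auto
  qed
  have Un: "(\<Union>R\<in>{a..<b}. cut_event R) = (\<Union>R\<in>{a..<b}. L R)"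
  proof (intro equalityI subsetI)
    fix x assume "x \<in> (\<Union>R\<in>{a..<b}. cut_event R)"
    then have ne: "{R \<in> {a..<b}. x \<in> cut_event R} \<noteq> {}" by blast
    define R where "R = Max {R \<in> {a..<b}. x \<in> cut_event R}"
    have R: "R \<in> {R \<in> {a..<b}. x \<in> cut_event R}" unfolding R_def using ne by (intro Max_in) auto
    have "x \<notin> cut_event k" if "k \<in> {R<..<b}" for k
    proof
      assume "x \<in> cut_event k"
      then have "k \<le> R" using that R unfolding R_def by (intro Max_ge) auto
      then show False using that by simp
    qed
    then show "x \<in> (\<Union>R\<in>{a..<b}. L R)" using R unfolding L_def by blast
  qed (auto simp: L_def)
  \<comment> \<open>That \<open>R\<close> is the last cut below \<open>b\<close> depends only on the
    path after its first visit to \<open>R + 1\<close>, so the renewal identity applies;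
    \<open>D_partial\<close> is at most its number of terms because all \<open>U\<close> are at most
    1.\<close>
  have past: "measure (Q 0) (cut_event R' \<inter> L R) \<ge> measure (Q 0) (L R) / real (Suc R - R')" if "R' < R" for R R'
  proof -
    define B where "B = avoiding R - (\<Union>k\<in>{R<..<b}. cut_event k)"
    have B: "B \<in> sets path_space" "B \<subseteq> avoiding R"
      unfolding B_def using avoiding_sets cut_event_sets by (auto intro!: sets.Diff sets.finite_UN)
    have AE: "AE x in Q 0. x \<in> L R \<longleftrightarrow> x \<in> after_first_visit (Suc R) B"
      using AE_escaping[of 0]
    proof eventually_elim
      case (elim x)
      have nn: "nn_path x" "x 0 \<le> Suc R" using elim by (auto simp: escaping_path_def)
      have "path_shift n x \<in> B \<longleftrightarrow> x \<in> L R" if n: "x \<in> first_visit (Suc R) n" for n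
      proof -
        have "path_shift n x \<in> cut_event k \<longleftrightarrow> x \<in> cut_event k" if "k \<in> {R<..<b}" for k
          using that by (intro cut_event_path_shift[OF nn n]) auto
        then show ?thesis
          unfolding B_def L_def using avoiding_iff_cut_event[OF n] by blast
      qed
      from after_first_visit_iff[OF elim _ this] show ?case by simp
    qed
    have Z: "after_first_visit (Suc R) B \<in> sets (Q 0)" using B(1) by (rule after_first_visit_sets)
    have "measure (Q 0) (cut_event R' \<inter> L R) = measure (Q 0) (cut_event R' \<inter> after_first_visit (Suc R) B)"
      using AE by (intro measure_Q_cong sets.Int cut L Z) (auto elim!: eventually_mono)
    also have "\<dots> = measure (Q 0) (after_first_visit (Suc R) B) / D_partial p R' (Suc R - R')"
      using that B by (rule cut_event_after_first_visit_prob)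
    also have "measure (Q 0) (after_first_visit (Suc R) B) = measure (Q 0) (L R)"
      using AE by (intro measure_Q_cong L Z) (auto elim!: eventually_mono)
    also have "measure (Q 0) (L R) / D_partial p R' (Suc R - R') \<ge> measure (Q 0) (L R) / real (Suc R - R')"
      using D_partial_le[of R' "Suc R - R'"] D_partial_ge_1[of "Suc R - R'" R'] that
      by (intro divide_left_mono) auto
    finally show ?thesis .
  qed
  have "measure (Q 0) (\<Union>R\<in>{a..<b}. cut_event R) * (\<Sum>d = 2..Suc w. 1 / real d) =
      (\<Sum>R = a..<b. measure (Q 0) (L R) * (\<Sum>d = 2..Suc w. 1 / real d))"
    unfolding Un using L disj by (subst Q.finite_measure_finite_Union) (auto simp: sum_distrib_right)
  also have "\<dots> = (\<Sum>R = a..<b. \<Sum>R' = R - w..<R. measure (Q 0) (L R) / real (Suc R - R'))"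
  proof (intro sum.cong refl)
    fix R assume "R \<in> {a..<b}"
    then have "w \<le> R" using assms by simp
    have "(\<Sum>d = 2..Suc w. 1 / real d) = (\<Sum>R' = R - w..<R. 1 / real (Suc R - R'))"
      using \<open>w \<le> R\<close> by (intro sum.reindex_bij_witness[of _ "\<lambda>R'. Suc R - R'" "\<lambda>d. Suc R - d"]) auto
    then show "measure (Q 0) (L R) * (\<Sum>d = 2..Suc w. 1 / real d) =
        (\<Sum>R' = R - w..<R. measure (Q 0) (L R) / real (Suc R - R'))"
      by (simp add: sum_distrib_left)
  qed
  also have "\<dots> \<le> (\<Sum>R = a..<b. \<Sum>R' = R - w..<R. measure (Q 0) (cut_event R' \<inter> L R))"
    by (intro sum_mono past) auto
  \<comment> \<open>The window of \<open>R'\<close> moves with \<open>R\<close>; enlarging it to a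
    fixed interval permits the exchange of the sums, after which the disjoint \<open>L R\<close> are
    summed out.\<close>
  also have "\<dots> \<le> (\<Sum>R = a..<b. \<Sum>R' = a - w..<b. measure (Q 0) (cut_event R' \<inter> L R))"
    by (intro sum_mono sum_mono2) auto
  also have "\<dots> = (\<Sum>R' = a - w..<b. \<Sum>R = a..<b. measure (Q 0) (cut_event R' \<inter> L R))"
    by (rule sum.swap)
  also have "\<dots> = (\<Sum>R' = a - w..<b. measure (Q 0) (\<Union>R\<in>{a..<b}. cut_event R' \<inter> L R))"
    using L cut disj
    by (intro sum.cong refl Q.finite_measure_finite_Union[symmetric]) (auto simp: disjoint_family_on_def)
  also have "\<dots> \<le> (\<Sum>R' = a - w..<b. measure (Q 0) (cut_event R'))"
    using cut by (intro sum_mono Q.finite_measure_mono) auto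
  finally show ?thesis by (simp add: cut_event_prob)
qed

text \<open>The window \<open>w\<close> is the length of the preceding block, so looking back never
  leaves the two blocks. The harmonic sum is then at least \<open>(k - 2) * ln 2\<close>, whereas
  \<open>ln R\<close> is at most \<open>(k + 1) * ln 2\<close>; the 4 comes from
  \<open>k + 1 \<le> 4 * (k - 2)\<close> for \<open>k \<ge> 3\<close>.\<close>

lemma dyadic_cut_block_prob:
  assumes "k \<ge> 3"
  shows "measure (Q 0) (\<Union>R\<in>{2^k..<2^Suc k}. cut_event R) \<le>
    4 * (\<Sum>R = 2^(k - 1)..<2^Suc k. 1 / (D p R * ln (real R)))"
proof -
  define w :: nat where "w = 2^(k - 1)"
  have k: "k = Suc (k - 1)" using assms by simp
  have w: "(2::nat)^k = w + w" unfolding w_def by (subst k) simp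
  have "0 < w" by (simp add: w_def)
  define H where "H = (\<Sum>d = 2..Suc w. 1 / real d)"
  have "ln (2 ^ (k - 2) * 2) = ln (real w)"
    unfolding w_def using assms by (metis One_nat_def Suc_1 Suc_diff_Suc Suc_le_lessD of_nat_numeral of_nat_power numeral_3_eq_3 power_Suc2 less_le_trans Suc_leD)
  then have "real (k - 2) * ln 2 + ln 2 = ln (real w)"
    by (simp add: ln_mult ln_realpow)
  also have "\<dots> \<le> ln (real w + 2)" using \<open>0 < w\<close> by simp
  finally have H1: "H \<ge> real (k - 2) * ln 2" using harmonic_tail_ge[of w] by (simp add: H_def)
  have "real (Suc k) \<le> 4 * real (k - 2)" using assms by simp
  from mult_right_mono[OF this, of "ln 2"] have "real (Suc k) * ln 2 \<le> 4 * (real (k - 2) * ln 2)"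
    by (simp only: mult.assoc) simp
  with H1 have H: "real (Suc k) * ln 2 \<le> 4 * H" by linarith
  have "0 < real (Suc k) * ln 2" by simp
  with H have Hpos: "H > 0" by linarith
  have "measure (Q 0) (\<Union>R\<in>{2^k..<2^Suc k}. cut_event R) * H \<le> (\<Sum>R = w..<2^Suc k. 1 / D p R)"
    using cut_block_prob[of w "2^k" "2^Suc k"] w by (simp add: H_def)
  also have "\<dots> \<le> (\<Sum>R = w..<2^Suc k. H * (4 * (1 / (D p R * ln (real R)))))"
  proof (intro sum_mono)
    fix R assume R: "R \<in> {w..<2^Suc k}"
    have "1 < w" unfolding w_def using assms by (intro one_less_power) auto
    then have lnR: "ln (real R) > 0" using R by simp
    have "real R \<le> 2 ^ Suc k" using R by (metis atLeastLessThan_iff less_imp_le of_nat_le_iff of_nat_numeral of_nat_power)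
    then have "ln (real R) \<le> ln (2 ^ Suc k)" using \<open>1 < w\<close> R by (subst ln_le_cancel_iff) auto
    also have "\<dots> = real (Suc k) * ln 2" by (rule ln_realpow)
    finally have "ln (real R) \<le> 4 * H" using H by linarith
    then show "1 / D p R \<le> H * (4 * (1 / (D p R * ln (real R))))"
      using lnR D_pos[of R] by (simp add: field_simps)
  qed
  also have "\<dots> = (4 * (\<Sum>R = w..<2^Suc k. 1 / (D p R * ln (real R)))) * H"
    by (simp add: sum_distrib_left sum_distrib_right mult_ac)
  finally show ?thesis using Hpos unfolding w_def by simp
qed

lemma AE_finitely_many_cuts:
  assumes "summable (\<lambda>n. 1 / (D p (n + 2) * ln (real (n + 2))))"
  shows "AE x in Q 0. finite {R. cutpoint x R}"
proof -
  define a where "a n = 1 / (D p n * ln (real n))" for n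
  have a_sum: "summable a"
    using assms unfolding a_def by (subst (asm) summable_iff_shift[of "\<lambda>n. 1 / (D p n * ln (real n))" 2])
  have a_nonneg: "a n \<ge> 0" for n
    using D_pos[of n] by (cases n) (auto simp: a_def)
  define S where "S k = (\<Sum>n = 2^k..<2^Suc k. a n)" for k
  have S_sum: "summable S" unfolding S_def by (rule summable_dyadic_blocks[OF a_sum a_nonneg])
  \<comment> \<open>The shift by 3 meets the condition \<open>k \<ge> 3\<close> of the block
    bound.\<close>
  define Bl where "Bl k = (\<Union>R\<in>{2^(k + 3)..<2^Suc (k + 3)}. cut_event R)" for k
  have Bl: "Bl k \<in> sets (Q 0)" for k
    unfolding Bl_def by (intro sets.finite_UN) (simp_all only: sets_Q cut_event_sets finite_atLeastLessThan)
  have "measure (Q 0) (Bl k) \<le> 4 * (S (k + 2) + S (k + 3))" for k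
  proof -
    have "S (k + 2) + S (k + 3) = (\<Sum>n = 2^(k + 2)..<2^Suc (k + 3). a n)"
      unfolding S_def using sum.atLeastLessThan_concat[of "2^(k+2)" "2^(k+3)" "2^(k+4)" a]
      by (simp add: eval_nat_numeral)
    then show ?thesis
      using dyadic_cut_block_prob[of "k + 3"] by (simp add: Bl_def a_def)
  qed
  moreover have "summable (\<lambda>k. 4 * (S (k + 2) + S (k + 3)))"
    using S_sum by (intro summable_mult summable_add summable_ignore_initial_segment)
  ultimately have "summable (\<lambda>k. measure (Q 0) (Bl k))"
    by (intro summable_comparison_test[of "\<lambda>k. measure (Q 0) (Bl k)"]) auto
  then have "AE x in Q 0. eventually (\<lambda>k. x \<in> space (Q 0) - Bl k) sequentially"
    using Bl by (intro borel_cantelli_AE1) (auto simp: Q.emeasure_eq_measure)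
  with AE_escaping[of 0] show ?thesis
  proof eventually_elim
    case (elim x)
    then obtain K where K: "\<And>k. k \<ge> K \<Longrightarrow> x \<notin> Bl k" by (auto simp: eventually_sequentially)
    have "R < 2 ^ (K + 3)" if "x \<in> cut_event R" for R
    proof (rule ccontr)
      assume *: "\<not> R < 2 ^ (K + 3)"
      then have "R > 0" by (metis gr0I zero_less_numeral zero_less_power)
      obtain n where n: "2 ^ n \<le> R" "R < 2 ^ Suc n"
        using ex_power_ivl1[of 2 R] \<open>R > 0\<close> by auto
      have "K + 3 \<le> n"
      proof (rule ccontr)
        assume "\<not> K + 3 \<le> n"
        then have "(2::nat) ^ Suc n \<le> 2 ^ (K + 3)" by (intro power_increasing) auto
        then show False using n * by linarith
      qed
      then have "x \<in> Bl (n - 3)" using n that by (auto simp: Bl_def)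
      then show False using K[of "n - 3"] \<open>K + 3 \<le> n\<close> by simp
    qed
    then have "{R. cutpoint x R} \<subseteq> {..<2 ^ (K + 3)}"
      using cutpoint_iff_cut_event[OF elim(1)] by auto
    then show ?case by (rule finite_subset) simp
  qed
qed

end

subsection \<open>Second moments\<close>

lemma sum_symmetric_split:
  fixes g :: "nat \<Rightarrow> nat \<Rightarrow> real"
  assumes "finite I" "\<And>j k. g j k = g k j"
  shows "(\<Sum>j\<in>I. \<Sum>k\<in>I. g j k) = (\<Sum>j\<in>I. g j j) + 2 * (\<Sum>j\<in>I. \<Sum>k | k \<in> I \<and> j < k. g j k)"
proof -
  have split: "(\<Sum>k\<in>I. g j k) = g j j + (\<Sum>k | k \<in> I \<and> j < k. g j k) + (\<Sum>k | k \<in> I \<and> k < j. g j k)"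
    if "j \<in> I" for j
  proof -
    have "I = insert j ({k \<in> I. j < k} \<union> {k \<in> I. k < j})" using that by auto
    then have "(\<Sum>k\<in>I. g j k) = (\<Sum>k\<in>insert j ({k \<in> I. j < k} \<union> {k \<in> I. k < j}). g j k)" by simp
    also have "\<dots> = g j j + (\<Sum>k\<in>{k \<in> I. j < k} \<union> {k \<in> I. k < j}. g j k)"
      using assms(1) by (intro sum.insert) auto
    also have "(\<Sum>k\<in>{k \<in> I. j < k} \<union> {k \<in> I. k < j}. g j k) =
        (\<Sum>k | k \<in> I \<and> j < k. g j k) + (\<Sum>k | k \<in> I \<and> k < j. g j k)"
      using assms(1) by (intro sum.union_disjoint) auto
    finally show ?thesis by simp
  qed
  have "(\<Sum>j\<in>I. \<Sum>k | k \<in> I \<and> k < j. g j k) = (\<Sum>k\<in>I. \<Sum>j | j \<in> I \<and> k < j. g j k)"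
    using assms(1) by (rule sum.swap_restrict) (rule assms(1))
  also have "\<dots> = (\<Sum>j\<in>I. \<Sum>k | k \<in> I \<and> j < k. g j k)"
    by (intro sum.cong refl assms(2))
  finally show ?thesis by (simp add: split sum.distrib)
qed

text \<open>This follows from \<open>2 * t * Y - (t * Y)\<^sup>2 \<le> indicator (Y \<noteq> 0)\<close> for the weighted count
  \<open>Y = (\<Sum>j\<in>I. w j * indicator (A j))\<close>.\<close>

lemma (in prob_space) second_moment_union:
  fixes w :: "'i \<Rightarrow> real"
  assumes "finite I" "\<And>j. j \<in> I \<Longrightarrow> A j \<in> events"
  shows "2 * t * (\<Sum>j\<in>I. w j * prob (A j)) - t\<^sup>2 * (\<Sum>j\<in>I. \<Sum>k\<in>I. w j * w k * prob (A j \<inter> A k))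
    \<le> prob (\<Union>j\<in>I. A j)"
proof -
  define Y where "Y x = (\<Sum>j\<in>I. w j * indicator (A j) x)" for x
  have Y2: "(Y x)\<^sup>2 = (\<Sum>j\<in>I. \<Sum>k\<in>I. w j * w k * indicator (A j \<inter> A k) x)" for x
    by (simp add: Y_def power2_eq_square sum_product indicator_inter_arith mult_ac)
  have ind: "integrable M (\<lambda>x. c * indicator B x :: real)" if "B \<in> events" for B c
    using that by (intro integrable_mult_right integrable_real_indicator) (auto simp: emeasure_eq_measure)
  have int: "integrable M Y" "integrable M (\<lambda>x. (Y x)\<^sup>2)"
    unfolding Y2 unfolding Y_def by (intro Bochner_Integration.integrable_sum ind sets.Int assms; assumption)+
  have E1: "expectation Y = (\<Sum>j\<in>I. w j * prob (A j))"
    unfolding Y_def using ind assms by (subst Bochner_Integration.integral_sum) auto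
  have E2: "expectation (\<lambda>x. (Y x)\<^sup>2) = (\<Sum>j\<in>I. \<Sum>k\<in>I. w j * w k * prob (A j \<inter> A k))"
    unfolding Y2
  proof (subst Bochner_Integration.integral_sum)
    show "integrable M (\<lambda>x. \<Sum>k\<in>I. w j * w k * indicator (A j \<inter> A k) x)" if "j \<in> I" for j
      by (intro Bochner_Integration.integrable_sum ind sets.Int assms that)
    show "(\<Sum>j\<in>I. expectation (\<lambda>x. \<Sum>k\<in>I. w j * w k * indicator (A j \<inter> A k) x)) =
        (\<Sum>j\<in>I. \<Sum>k\<in>I. w j * w k * prob (A j \<inter> A k))"
    proof (intro sum.cong refl)
      fix j assume "j \<in> I"
      then have "expectation (\<lambda>x. \<Sum>k\<in>I. w j * w k * indicator (A j \<inter> A k) x) =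
          (\<Sum>k\<in>I. expectation (\<lambda>x. w j * w k * indicator (A j \<inter> A k) x))"
        by (intro Bochner_Integration.integral_sum ind sets.Int assms)
      then show "expectation (\<lambda>x. \<Sum>k\<in>I. w j * w k * indicator (A j \<inter> A k) x) =
          (\<Sum>k\<in>I. w j * w k * prob (A j \<inter> A k))"
        using assms(2) \<open>j \<in> I\<close> by (simp add: sets.Int)
    qed
  qed
  have Un: "(\<Union>j\<in>I. A j) \<in> events" using assms by auto
  have le: "2 * t * Y x - t\<^sup>2 * (Y x)\<^sup>2 \<le> indicator (\<Union>j\<in>I. A j) x" for x
  proof (cases "x \<in> (\<Union>j\<in>I. A j)")
    case True
    have "0 \<le> (1 - t * Y x)\<^sup>2" by simp
    then show ?thesis using True by (simp add: power2_eq_square algebra_simps)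
  next
    case False
    then have "Y x = 0" unfolding Y_def by (intro sum.neutral) auto
    then show ?thesis by simp
  qed
  have "2 * t * expectation Y - t\<^sup>2 * expectation (\<lambda>x. (Y x)\<^sup>2) = expectation (\<lambda>x. 2 * t * Y x - t\<^sup>2 * (Y x)\<^sup>2)"
    using int by (simp add: mult.assoc)
  also have "\<dots> \<le> expectation (indicator (\<Union>j\<in>I. A j))"
    using int Un le by (intro integral_mono) (auto simp: emeasure_eq_measure intro!: integrable_real_indicator)
  also have "\<dots> = prob (\<Union>j\<in>I. A j)" using Un by simp
  finally show ?thesis unfolding E1 E2 .
qed

section \<open>Logarithmic estimates\<close>

text \<open>Comparison with the primitive \<open>ln (ln x)\<close> of \<open>1 / (x * ln x)\<close>:
  one step is \<open>ln u \<le> u - 1\<close> at the quotient \<open>u\<close> of consecutive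
  logarithms.\<close>

lemma sum_inverse_n_ln_ge:
  assumes "3 \<le> j" "j \<le> k"
  shows "ln (ln (real k)) - ln (ln (real j)) \<le> (\<Sum>m = j..<k. 1 / (real m * ln (real m)))"
  using assms(2)
proof (induction k rule: dec_induct)
  case (step m)
  have m: "real m > 1" "ln (real m) > 0" using step(1) assms(1) by auto
  have "ln (ln (real (Suc m))) - ln (ln (real m)) = ln (ln (real (Suc m)) / ln (real m))"
    using m by (subst ln_div) auto
  also have "\<dots> \<le> ln (real (Suc m)) / ln (real m) - 1"
    using m by (intro ln_le_minus_one divide_pos_pos) auto
  also have "\<dots> = (ln (real (Suc m)) - ln (real m)) / ln (real m)"
    using m by (simp add: diff_divide_distrib)
  also have "ln (real (Suc m)) - ln (real m) = ln (1 + 1 / real m)"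
  proof -
    have "1 + 1 / real m = real (Suc m) / real m" using m by (simp add: field_simps)
    then show ?thesis using m by (simp add: ln_div)
  qed
  also have "ln (1 + 1 / real m) / ln (real m) \<le> (1 / real m) / ln (real m)"
    using m by (intro divide_right_mono ln_add_one_self_le_self) auto
  finally show ?case using step by simp
qed simp

lemma harmonic_le: "n > 0 \<Longrightarrow> (\<Sum>i = 1..n. 1 / real i) \<le> 1 + ln (real n)"
proof (induction n rule: nat_induct_non_zero)
  case (Suc n)
  have "1 / real (Suc n) \<le> ln (real (Suc n)) - ln (real n)"
  proof -
    have "ln (real n / real (Suc n)) \<le> real n / real (Suc n) - 1"
      using Suc(1) by (intro ln_le_minus_one) auto
    also have "\<dots> = - 1 / real (Suc n)" by (simp add: field_simps)
    finally show ?thesis using Suc(1) by (simp add: ln_div)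
  qed
  with Suc show ?case by simp
qed simp

section \<open>Partial sums of D and pair correlations\<close>

context walk_laws
begin

lemma D_rec: "D p l = 1 + U p (Suc l) * D p (Suc l)"
proof -
  have "D_partial p l (Suc d) = 1 + U p (Suc l) * D_partial p (Suc l) d" for d
  proof -
    have "(\<Prod>i = 1..Suc j. U p (l + i)) = U p (Suc l) * (\<Prod>i = 1..j. U p (Suc l + i))" for j
      by (induction j) simp_all
    then show ?thesis
      unfolding D_partial_def sum.lessThan_Suc_shift by (simp add: sum_distrib_left)
  qed
  moreover have lim: "(\<lambda>d. D_partial p l d) \<longlonglongrightarrow> D p l" for l
    using D_sums[of l] by (simp add: sums_def D_partial_def avoid_prob_D)
  ultimately have "(\<lambda>d. 1 + U p (Suc l) * D_partial p (Suc l) d) \<longlonglongrightarrow> D p l"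
    using LIMSEQ_Suc[OF lim[of l]] by simp
  moreover have "(\<lambda>d. 1 + U p (Suc l) * D_partial p (Suc l) d) \<longlonglongrightarrow> 1 + U p (Suc l) * D p (Suc l)"
    by (intro tendsto_intros lim)
  ultimately show ?thesis by (rule LIMSEQ_unique)
qed

lemma D_split: "D p l = D_partial p l d + (\<Prod>i = 1..d. U p (l + i)) * D p (l + d)"
proof (induction d)
  case (Suc d)
  then show ?case by (subst Suc, subst D_rec[of "l + d"]) (simp add: D_partial_def algebra_simps)
qed (simp add: D_partial_def)

text \<open>All \<open>U\<close> are at most 1, so the products decrease and the last one is at most
  the average of the first \<open>d + 1\<close>. Inserting this into the remainder of
  \<open>D_split\<close> gives the bound.\<close>

lemma D_near: "D p j \<le> D_partial p j (Suc d) * (1 + D p (j + d) / real (Suc d))"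
proof -
  let ?P = "\<lambda>d. \<Prod>i = 1..d. U p (j + i)"
  have P_nonneg: "?P d \<ge> 0" for d
    using U_bounds by (intro prod_nonneg) (auto intro: less_imp_le)
  have "decseq ?P"
    unfolding decseq_Suc_iff using U_bounds P_nonneg by (auto intro!: mult_left_le)
  then have "(\<Sum>i<Suc d. ?P d) \<le> D_partial p j (Suc d)"
    unfolding D_partial_def by (intro sum_mono) (auto simp: decseq_def)
  then have P: "?P d \<le> D_partial p j (Suc d) / real (Suc d)"
    by (simp add: field_simps)
  have "D p j = D_partial p j d + ?P d * D p (j + d)" by (rule D_split)
  also have "\<dots> \<le> D_partial p j (Suc d) + D_partial p j (Suc d) / real (Suc d) * D p (j + d)"
    using P P_nonneg[of d] D_pos[of "j + d"]
    by (intro add_mono mult_right_mono) (auto simp: D_partial_def)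
  finally show ?thesis by (simp add: algebra_simps)
qed

text \<open>\<open>D_rec\<close> reads
  \<open>U p (Suc m) * D p (Suc m) = D p m * (1 - 1 / D p m)\<close>, so the remainder in
  \<open>D_split\<close> telescopes to \<open>D p j\<close> times a product, which is bounded by an
  exponential.\<close>

lemma D_far: "D p j * (1 - exp (- (\<Sum>m = j..<j + d. 1 / D p m))) \<le> D_partial p j d"
proof -
  have eq: "(\<Prod>i = 1..d. U p (j + i)) * D p (j + d) = D p j * (\<Prod>m = j..<j + d. 1 - 1 / D p m)"
  proof (induction d)
    case (Suc d)
    have "D p (j + d) * (1 - 1 / D p (j + d)) = U p (Suc (j + d)) * D p (Suc (j + d))"
      using D_rec[of "j + d"] D_pos[of "j + d"] by (simp add: field_simps)
    note D_eq = this
    have "(\<Prod>i = 1..Suc d. U p (j + i)) * D p (j + Suc d) =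
        (\<Prod>i = 1..d. U p (j + i)) * (U p (Suc (j + d)) * D p (Suc (j + d)))" by simp
    also have "\<dots> = (\<Prod>i = 1..d. U p (j + i)) * D p (j + d) * (1 - 1 / D p (j + d))"
      by (simp only: D_eq[symmetric] mult.assoc)
    also have "\<dots> = D p j * (\<Prod>m = j..<j + Suc d. 1 - 1 / D p m)"
      by (simp only: Suc) simp
    finally show ?case .
  qed simp
  have "(\<Prod>m = j..<j + d. 1 - 1 / D p m) \<le> (\<Prod>m = j..<j + d. exp (- (1 / D p m)))"
  proof (intro prod_mono conjI)
    fix m
    show "0 \<le> 1 - 1 / D p m" using D_ge_1[of m] D_pos[of m] by simp
    show "1 - 1 / D p m \<le> exp (- (1 / D p m))" using exp_ge_add_one_self[of "- (1 / D p m)"] by simp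
  qed
  also have "\<dots> = exp (- (\<Sum>m = j..<j + d. 1 / D p m))" by (simp add: exp_sum sum_negf[symmetric])
  finally have "D p j * (\<Prod>m = j..<j + d. 1 - 1 / D p m) \<le> D p j * exp (- (\<Sum>m = j..<j + d. 1 / D p m))"
    using D_pos[of j] by (intro mult_left_mono) auto
  then show ?thesis using D_split[of j d] unfolding eq right_diff_distrib mult_1_right by linarith
qed

text \<open>A strong cutpoint is a cutpoint, so both upper bounds are exact probabilities for
  cutpoints; for the pair it is the renewal identity with the plain future of avoiding
  \<open>k\<close>.\<close>

lemma single_visit_prob_le: "measure (Q 0) (single_visit R) \<le> 1 / D p R"
  and single_visit_pair_prob: "j < k \<Longrightarrow>
    measure (Q 0) (single_visit j \<inter> single_visit k) \<le> 1 / (D p k * D_partial p j (Suc (k - j)))"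
proof -
  have cut: "cut_event R \<in> sets (Q 0)" and single: "single_visit R \<in> sets (Q 0)" for R
    by (simp_all only: sets_Q cut_event_sets single_visit_sets)
  have sub: "AE x in Q 0. \<forall>R. x \<in> single_visit R \<longrightarrow> x \<in> cut_event R"
    using AE_escaping[of 0]
  proof eventually_elim
    case (elim x)
    have "strong_cutpoint x R \<Longrightarrow> cutpoint x R" for R
      unfolding strong_cutpoint_def cutpoint_def by (metis le_neq_implies_less less_imp_le order_refl)
    then show ?case
      using strong_cutpoint_iff_single_visit[OF elim] cutpoint_iff_cut_event[OF elim] by blast
  qed
  show "measure (Q 0) (single_visit R) \<le> 1 / D p R" for R
    unfolding cut_event_prob[symmetric] using sub cut
    by (intro Q.finite_measure_mono_AE) (auto elim!: eventually_mono)
  assume jk: "j < k"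
  have Z: "after_first_visit (Suc k) (avoiding k) \<in> sets (Q 0)" by (rule after_first_visit_sets[OF avoiding_sets])
  have AE: "AE x in Q 0. x \<in> cut_event k \<longleftrightarrow> x \<in> after_first_visit (Suc k) (avoiding k)"
    using AE_escaping[of 0]
  proof eventually_elim
    case (elim x)
    from after_first_visit_iff[OF elim _ avoiding_iff_cut_event] show ?case by simp
  qed
  have "measure (Q 0) (single_visit j \<inter> single_visit k) \<le>
      measure (Q 0) (cut_event j \<inter> after_first_visit (Suc k) (avoiding k))"
  proof (rule Q.finite_measure_mono_AE)
    show "AE x in Q 0. x \<in> single_visit j \<inter> single_visit k \<longrightarrow>
        x \<in> cut_event j \<inter> after_first_visit (Suc k) (avoiding k)"
      using sub AE by eventually_elim blast
  qed (intro sets.Int cut Z)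
  also have "\<dots> = measure (Q 0) (after_first_visit (Suc k) (avoiding k)) / D_partial p j (Suc k - j)"
    by (rule cut_event_after_first_visit_prob[OF jk avoiding_sets order_refl])
  also have "measure (Q 0) (after_first_visit (Suc k) (avoiding k)) = 1 / D p k"
    unfolding cut_event_prob[symmetric] using AE by (intro measure_Q_cong cut Z) (auto elim!: eventually_mono)
  finally show "measure (Q 0) (single_visit j \<inter> single_visit k) \<le> 1 / (D p k * D_partial p j (Suc (k - j)))"
    using jk by (simp add: Suc_diff_le)
qed

lemma single_visit_pair_near:
  assumes "j < k"
  shows "measure (Q 0) (single_visit j \<inter> single_visit k) \<le> 1 / D p j * (1 / D p k) + 1 / D p j * (1 / real (k - j))"
proof -
  let ?d = "D_partial p j (Suc (k - j))"
  have d: "?d > 0" using D_partial_ge_1[of "Suc (k - j)" j] by simp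
  have pos: "D p j > 0" "D p k > 0" by (rule D_pos)+
  have "D p j \<le> ?d * (1 + D p k / real (Suc (k - j)))" using D_near[of j "k - j"] assms by simp
  also have "\<dots> \<le> ?d * (1 + D p k / real (k - j))"
    using d pos assms by (intro mult_left_mono add_left_mono divide_left_mono) auto
  finally have "1 / (D p k * ?d) \<le> (1 + D p k / real (k - j)) / (D p j * D p k)"
    using d pos by (simp add: divide_le_eq le_divide_eq mult_ac)
  also have "\<dots> = 1 / D p j * (1 / D p k) + 1 / D p j * (1 / real (k - j))"
    using pos by (simp add: add_divide_distrib)
  finally show ?thesis by (rule order_trans[OF single_visit_pair_prob[OF assms]])
qed

text \<open>Squaring doubles the logarithm and raises \<open>ln ln\<close> by \<open>ln 2\<close>.
  Hence between \<open>j\<close> and \<open>k\<close> the reciprocals of \<open>D\<close> add up to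
  at least \<open>ln 2 / \<delta>\<close>, and by \<open>D_far\<close> the partial sum has reached
  the fraction \<open>1 - exp (- (ln 2 / \<delta>))\<close> of \<open>D p j\<close>.\<close>

lemma single_visit_pair_far:
  assumes \<delta>: "\<delta> > 0" and bound: "\<And>m. m \<ge> j \<Longrightarrow> D p m \<le> \<delta> * real m * ln (real m)"
    and "3 \<le> j" "j\<^sup>2 \<le> k"
  shows "measure (Q 0) (single_visit j \<inter> single_visit k) \<le>
    1 / (1 - exp (- (ln 2 / \<delta>))) * (1 / D p j) * (1 / D p k)"
proof -
  have "j < j\<^sup>2" using assms(3) by (simp add: power2_eq_square)
  then have jk: "j < k" using assms(4) by simp
  let ?d = "D_partial p j (Suc (k - j))"
  have lnj: "ln (real j) > 0" using assms(3) by simp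
  have "ln (real (j\<^sup>2)) = 2 * ln (real j)" using assms(3) by (simp add: ln_realpow)
  moreover have "real (j\<^sup>2) \<le> real (Suc k)" using assms(4) by (simp only: of_nat_le_iff)
  then have "ln (real (j\<^sup>2)) \<le> ln (real (Suc k))"
    by (rule ln_le_cancel_iff[THEN iffD2, rotated 2]) (use assms(3) in simp_all)
  ultimately have "ln (2 * ln (real j)) \<le> ln (ln (real (Suc k)))"
    using lnj jk by (subst ln_le_cancel_iff) auto
  then have "ln 2 \<le> ln (ln (real (Suc k))) - ln (ln (real j))" using lnj by (simp add: ln_mult)
  also have "\<dots> \<le> (\<Sum>m = j..<Suc k. 1 / (real m * ln (real m)))"
    using assms(3) jk by (intro sum_inverse_n_ln_ge) auto
  also have "\<dots> \<le> (\<Sum>m = j..<Suc k. \<delta> * (1 / D p m))"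
  proof (intro sum_mono)
    fix m assume m: "m \<in> {j..<Suc k}"
    then have "real m * ln (real m) > 0" using assms(3) by (intro mult_pos_pos) auto
    then show "1 / (real m * ln (real m)) \<le> \<delta> * (1 / D p m)"
      using bound[of m] m D_pos[of m] \<delta> by (simp add: divide_le_eq le_divide_eq mult_ac)
  qed
  also have "\<dots> = \<delta> * (\<Sum>m = j..<j + Suc (k - j). 1 / D p m)"
    using jk by (simp only: sum_distrib_left) simp
  finally have "ln 2 / \<delta> \<le> (\<Sum>m = j..<j + Suc (k - j). 1 / D p m)"
    using \<delta> by (simp add: divide_le_eq mult.commute)
  then have "1 - exp (- (ln 2 / \<delta>)) \<le> 1 - exp (- (\<Sum>m = j..<j + Suc (k - j). 1 / D p m))" by simp
  then have "D p j * (1 - exp (- (ln 2 / \<delta>))) \<le> D p j * (1 - exp (- (\<Sum>m = j..<j + Suc (k - j). 1 / D p m)))"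
    using D_pos[of j] by (intro mult_left_mono) auto
  also have "\<dots> \<le> ?d" by (rule D_far)
  finally have d: "D p j * (1 - exp (- (ln 2 / \<delta>))) \<le> ?d" .
  have "1 - exp (- (ln 2 / \<delta>)) > 0" using \<delta> by simp
  then have "1 / (D p k * ?d) \<le> 1 / (D p k * (D p j * (1 - exp (- (ln 2 / \<delta>)))))"
    using d D_pos[of j] D_pos[of k] D_partial_ge_1[of "Suc (k - j)" j]
    by (intro divide_left_mono mult_left_mono mult_pos_pos) auto
  also have "\<dots> = 1 / (1 - exp (- (ln 2 / \<delta>))) * (1 / D p j) * (1 / D p k)" by simp
  finally show ?thesis by (rule order_trans[OF single_visit_pair_prob[OF jk]])
qed

end

lemma exists_partial_sum_ge_1:
  fixes f :: "nat \<Rightarrow> real"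
  assumes "\<not> summable f" "\<And>n. n \<ge> a \<Longrightarrow> f n \<ge> 0"
  shows "\<exists>b. (\<Sum>n = a..<b. f n) \<ge> 1"
proof (rule ccontr)
  assume *: "\<not> ?thesis"
  have "summable (\<lambda>n. f (n + a))"
  proof (rule summableI_nonneg_bounded)
    fix N
    have "(\<Sum>n<N. f (n + a)) = (\<Sum>n = a..<N + a. f n)"
      by (simp add: atLeast0LessThan[symmetric] sum.shift_bounds_nat_ivl[of f 0 a N, simplified])
    then show "(\<Sum>n<N. f (n + a)) \<le> 1" using * by (metis nle_le)
  qed (simp add: assms(2))
  then show False using assms(1) by (simp add: summable_iff_shift)
qed

section \<open>The second moment method on a block\<close>

context walk_laws
begin

text \<open>For a fixed lower site \<open>j\<close>, every \<open>k\<close> gives a product term,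
  and \<open>e k\<close> is the excess present only for \<open>k < j\<^sup>2\<close>. There the
  weight is at most \<open>1 / ln j\<close> and the harmonic sum at most
  \<open>1 + 2 * ln j\<close>; the quotient is at most 3 because \<open>j \<ge> 3\<close> makes
  \<open>ln j \<ge> 1\<close>.\<close>

lemma single_visit_second_moment_row:
  assumes \<delta>: "\<delta> > 0" and bound: "\<And>m. m \<ge> j \<Longrightarrow> D p m \<le> \<delta> * real m * ln (real m)"
    and j: "3 \<le> j" "a \<le> j"
  defines "C \<equiv> 1 / (1 - exp (- (ln 2 / \<delta>)))"
  shows "(\<Sum>k | k \<in> {a..<b} \<and> j < k. 1 / ln (real k) * measure (Q 0) (single_visit j \<inter> single_visit k)) \<le>
    1 / D p j * (C * (\<Sum>k = a..<b. 1 / (D p k * ln (real k))) + 3)"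
proof -
  \<comment> \<open>\<open>C \<ge> 1\<close> lets the product terms of the near and the far range
    share one constant.\<close>
  have "exp (- (ln 2 / \<delta>)) < 1" using \<delta> by simp
  moreover have "exp (- (ln 2 / \<delta>)) > 0" by simp
  ultimately have C: "C \<ge> 1" unfolding C_def by (simp add: le_divide_eq)
  have ln_ge_1: "ln (real k) \<ge> 1" if "k \<ge> 3" for k
  proof -
    have "exp 1 \<le> real k" using exp_le that by linarith
    then show ?thesis using that by (simp add: ln_ge_iff)
  qed
  have lnj: "ln (real j) \<ge> 1" using j(1) by (rule ln_ge_1)
  have pos: "D p k > 0" for k by (rule D_pos)
  define e where "e k = (if k < j\<^sup>2 then 1 / ln (real j) * (1 / real (k - j)) else 0)" for k
  have e_nonneg: "e k \<ge> 0" for k using lnj by (simp add: e_def)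
  have pair_le: "1 / ln (real k) * measure (Q 0) (single_visit j \<inter> single_visit k) \<le>
      1 / D p j * (C * (1 / (D p k * ln (real k))) + e k)" if "j < k" for k
  proof -
    have lnk: "ln (real k) \<ge> 1" using that j(1) by (intro ln_ge_1) simp
    have mono: "1 / ln (real k) \<le> 1 / ln (real j)"
      using that lnj j(1) by (intro divide_left_mono) auto
    show ?thesis
    proof (cases "k < j\<^sup>2")
      case True
      have "1 / ln (real k) * measure (Q 0) (single_visit j \<inter> single_visit k) \<le>
          1 / ln (real k) * (1 / D p j * (1 / D p k) + 1 / D p j * (1 / real (k - j)))"
        using single_visit_pair_near[OF that] lnk by (intro mult_left_mono) auto
      also have "\<dots> = 1 / D p j * (1 * (1 / (D p k * ln (real k))) + 1 / ln (real k) * (1 / real (k - j)))"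
        by (simp add: algebra_simps)
      also have "\<dots> \<le> 1 / D p j * (C * (1 / (D p k * ln (real k))) + 1 / ln (real j) * (1 / real (k - j)))"
        using C mono lnk pos[of j] pos[of k]
        by (intro mult_left_mono add_mono mult_right_mono) auto
      finally show ?thesis using True by (simp add: e_def)
    next
      case False
      have "1 / ln (real k) * measure (Q 0) (single_visit j \<inter> single_visit k) \<le>
          1 / ln (real k) * (C * (1 / D p j) * (1 / D p k))"
        unfolding C_def using single_visit_pair_far[OF \<delta> bound j(1), of k] lnk False
        by (intro mult_left_mono) auto
      then show ?thesis using False by (simp add: e_def mult_ac)
    qed
  qed
  have "(\<Sum>k | k \<in> {a..<b} \<and> j < k. e k) \<le> (\<Sum>k\<in>{j<..<j\<^sup>2}. e k)"
  proof -
    have "(\<Sum>k | k \<in> {a..<b} \<and> j < k. e k) = (\<Sum>k | k \<in> {a..<b} \<and> j < k \<and> k < j\<^sup>2. e k)"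
      by (intro sum.mono_neutral_right) (auto simp: e_def)
    also have "\<dots> \<le> (\<Sum>k\<in>{j<..<j\<^sup>2}. e k)"
      using e_nonneg by (intro sum_mono2) auto
    finally show ?thesis .
  qed
  also have "\<dots> = (\<Sum>i = 1..j\<^sup>2 - Suc j. 1 / ln (real j) * (1 / real i))"
    by (intro sum.reindex_bij_witness[of _ "\<lambda>i. i + j" "\<lambda>k. k - j"]) (auto simp: e_def)
  also have "\<dots> \<le> (\<Sum>i = 1..j\<^sup>2. 1 / ln (real j) * (1 / real i))"
    using lnj by (intro sum_mono2) auto
  also have "\<dots> = 1 / ln (real j) * (\<Sum>i = 1..j\<^sup>2. 1 / real i)"
    by (simp add: sum_distrib_left)
  also have "\<dots> \<le> 1 / ln (real j) * (1 + ln (real (j\<^sup>2)))"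
    using lnj j(1) by (intro mult_left_mono harmonic_le) auto
  also have "ln (real (j\<^sup>2)) = 2 * ln (real j)" using j(1) by (simp add: ln_realpow)
  also have "1 / ln (real j) * (1 + 2 * ln (real j)) \<le> 3"
    using lnj by (simp add: field_simps)
  finally have e: "(\<Sum>k | k \<in> {a..<b} \<and> j < k. e k) \<le> 3" .
  have "(\<Sum>k | k \<in> {a..<b} \<and> j < k. 1 / ln (real k) * measure (Q 0) (single_visit j \<inter> single_visit k)) \<le>
      (\<Sum>k | k \<in> {a..<b} \<and> j < k. 1 / D p j * (C * (1 / (D p k * ln (real k))) + e k))"
    by (intro sum_mono pair_le) auto
  also have "\<dots> = 1 / D p j * (C * (\<Sum>k | k \<in> {a..<b} \<and> j < k. 1 / (D p k * ln (real k))) +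
      (\<Sum>k | k \<in> {a..<b} \<and> j < k. e k))"
    by (simp only: sum_distrib_left sum.distrib distrib_left)
  also have "\<dots> \<le> 1 / D p j * (C * (\<Sum>k = a..<b. 1 / (D p k * ln (real k))) + 3)"
  proof (intro mult_left_mono add_mono e)
    show "(\<Sum>k | k \<in> {a..<b} \<and> j < k. 1 / (D p k * ln (real k))) \<le> (\<Sum>k = a..<b. 1 / (D p k * ln (real k)))"
    proof (rule sum_mono2)
      fix k
      show "0 \<le> 1 / (D p k * ln (real k))" using pos[of k] by (cases k) auto
    qed auto
  qed (use C pos[of j] in auto)
  finally show ?thesis .
qed

text \<open>The first moment is at least \<open>S / 2\<close> and the second at most
  \<open>K * S\<^sup>2\<close>, where \<open>S \<ge> 1\<close> absorbs the linear terms. The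
  resulting bound depends on \<delta> alone and not on the block.\<close>

lemma single_visit_block_prob:
  assumes \<delta>: "\<delta> > 0" and bound: "\<And>m. m \<ge> a \<Longrightarrow> D p m \<le> \<delta> * real m * ln (real m)"
    and a: "3 \<le> a"
    and S: "(\<Sum>k = a..<b. 1 / (D p k * ln (real k))) \<ge> 1"
  defines "C \<equiv> 1 / (1 - exp (- (ln 2 / \<delta>)))"
  shows "measure (Q 0) (\<Union>R\<in>{a..<b}. single_visit R) \<ge> 1 / (4 * (2 * C + 7))"
proof -
  define S where "S = (\<Sum>k = a..<b. 1 / (D p k * ln (real k)))"
  \<comment> \<open>Off-diagonal pairs count twice and give \<open>2 * C + 2 * 3\<close>; the
    diagonal adds 1.\<close>
  define K where "K = 2 * C + 7"
  have "1 - exp (- (ln 2 / \<delta>)) > 0" using \<delta> by simp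
  then have K: "K > 0" unfolding K_def C_def by (intro add_nonneg_pos) auto
  have S1: "S \<ge> 1" using assms(4) by (simp add: S_def)
  let ?w = "\<lambda>j. 1 / ln (real j)"
  let ?P = "\<lambda>j k. measure (Q 0) (single_visit j \<inter> single_visit k)"
  have pos: "D p k > 0" for k by (rule D_pos)
  have w: "0 < ?w j" "?w j \<le> 1" if "j \<in> {a..<b}" for j
  proof -
    have "exp 1 \<le> real j" using exp_le that a by auto
    then have "ln (real j) \<ge> 1" using that a by (simp add: ln_ge_iff)
    then show "0 < ?w j" "?w j \<le> 1" by auto
  qed
  have M1: "(\<Sum>j = a..<b. ?w j * measure (Q 0) (single_visit j)) \<ge> S / 2"
  proof -
    have "S / 2 = (\<Sum>j = a..<b. ?w j * (1 / (2 * D p j)))"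
      unfolding S_def by (simp add: sum_divide_distrib mult_ac)
    also have "\<dots> \<le> (\<Sum>j = a..<b. ?w j * measure (Q 0) (single_visit j))"
      using w by (intro sum_mono mult_left_mono single_visit_prob_ge) (auto intro: less_imp_le)
    finally show ?thesis .
  qed
  have M2: "(\<Sum>j = a..<b. \<Sum>k = a..<b. ?w j * ?w k * ?P j k) \<le> K * S\<^sup>2"
  proof -
    have diag: "(\<Sum>j = a..<b. ?w j * ?w j * ?P j j) \<le> S"
      unfolding S_def
    proof (intro sum_mono)
      fix j assume j: "j \<in> {a..<b}"
      have "?w j * ?w j * ?P j j \<le> ?w j * 1 * (1 / D p j)"
        using w[OF j] single_visit_prob_le[of j] by (intro mult_mono) auto
      then show "?w j * ?w j * ?P j j \<le> 1 / (D p j * ln (real j))" by (simp add: mult_ac)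
    qed
    have "(\<Sum>j = a..<b. \<Sum>k | k \<in> {a..<b} \<and> j < k. ?w j * ?w k * ?P j k) \<le>
        (\<Sum>j = a..<b. ?w j * (1 / D p j * (C * S + 3)))"
    proof (intro sum_mono)
      fix j assume j: "j \<in> {a..<b}"
      have "(\<Sum>k | k \<in> {a..<b} \<and> j < k. ?w j * ?w k * ?P j k) =
          ?w j * (\<Sum>k | k \<in> {a..<b} \<and> j < k. ?w k * ?P j k)"
        by (simp only: sum_distrib_left mult.assoc)
      also have "\<dots> \<le> ?w j * (1 / D p j * (C * S + 3))"
        unfolding S_def C_def using j w(1)[OF j] a
        by (intro mult_left_mono single_visit_second_moment_row[OF \<delta> bound]) auto
      finally show "(\<Sum>k | k \<in> {a..<b} \<and> j < k. ?w j * ?w k * ?P j k) \<le> ?w j * (1 / D p j * (C * S + 3))" .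
    qed
    also have "\<dots> = S * (C * S + 3)"
      unfolding S_def by (simp add: sum_distrib_right mult_ac)
    finally have off: "(\<Sum>j = a..<b. \<Sum>k | k \<in> {a..<b} \<and> j < k. ?w j * ?w k * ?P j k) \<le> S * (C * S + 3)" .
    have "(\<Sum>j = a..<b. \<Sum>k = a..<b. ?w j * ?w k * ?P j k) =
        (\<Sum>j = a..<b. ?w j * ?w j * ?P j j) + 2 * (\<Sum>j = a..<b. \<Sum>k | k \<in> {a..<b} \<and> j < k. ?w j * ?w k * ?P j k)"
      by (rule sum_symmetric_split) (simp_all add: Int_commute mult_ac)
    also have "\<dots> \<le> S + 2 * (S * (C * S + 3))" using diag off by linarith
    also have "\<dots> = 2 * C * S\<^sup>2 + 7 * S" by (simp add: power2_eq_square algebra_simps)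
    also have "\<dots> \<le> 2 * C * S\<^sup>2 + 7 * S\<^sup>2" using S1 by (simp add: power2_eq_square)
    finally show ?thesis by (simp add: K_def algebra_simps)
  qed
  \<comment> \<open>This \<open>t\<close> maximises
    \<open>t * S - t\<^sup>2 * K * S\<^sup>2\<close>, and the maximum is
    \<open>1 / (4 * K)\<close>.\<close>
  define t where "t = 1 / (2 * K * S)"
  have t: "t > 0" unfolding t_def using K S1 by simp
  have "1 / (4 * K) = 2 * t * (S / 2) - t\<^sup>2 * (K * S\<^sup>2)"
    unfolding t_def using K S1 by (simp add: field_simps power2_eq_square)
  also have "\<dots> \<le> 2 * t * (\<Sum>j = a..<b. ?w j * measure (Q 0) (single_visit j)) -
      t\<^sup>2 * (\<Sum>j = a..<b. \<Sum>k = a..<b. ?w j * ?w k * ?P j k)"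
    using M1 M2 t by (intro diff_mono mult_left_mono) auto
  also have "\<dots> \<le> measure (Q 0) (\<Union>R\<in>{a..<b}. single_visit R)"
    by (rule Q.second_moment_union) (simp_all only: sets_Q single_visit_sets finite_atLeastLessThan)
  finally show ?thesis by (simp add: K_def)
qed

text \<open>A divergent series has blocks of sum at least 1 arbitrarily far out, and the block bound
  is the same \<open>c\<close> for all of them. By continuity from above the limsup event has
  probability at least \<open>c > 0\<close>, hence 1 by the zero-one law.\<close>

lemma AE_infinitely_many_strong_cutpoints:
  assumes \<delta>: "\<delta> > 0" and bound: "\<And>m. m \<ge> n0 \<Longrightarrow> D p m \<le> \<delta> * real m * ln (real m)"
    and div: "\<not> summable (\<lambda>n. 1 / (D p (n + 2) * ln (real (n + 2))))"
  shows "AE x in Q 0. infinite {R. strong_cutpoint x R}"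
proof -
  define f where "f n = 1 / (D p n * ln (real n))" for n
  have f: "\<not> summable f" using div summable_iff_shift[of f 2] by (simp add: f_def)
  have f_nonneg: "f n \<ge> 0" for n using D_pos[of n] by (cases n) (auto simp: f_def)
  define c where "c = 1 / (4 * (2 * (1 / (1 - exp (- (ln 2 / \<delta>)))) + 7))"
  have "1 - exp (- (ln 2 / \<delta>)) > 0" using \<delta> by simp
  then have c: "c > 0" unfolding c_def by (intro divide_pos_pos mult_pos_pos add_nonneg_pos) auto
  let ?A = "\<lambda>N. \<Union>R\<in>{N..}. single_visit R"
  have single: "single_visit R \<in> sets (Q 0)" for R by (simp only: sets_Q single_visit_sets)
  have A: "?A N \<in> sets (Q 0)" for N using single by (intro sets.countable_UN') auto
  have ge: "c \<le> measure (Q 0) (?A N)" for N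
  proof -
    define a where "a = max N (max n0 3)"
    obtain b where "(\<Sum>n = a..<b. f n) \<ge> 1"
      using exists_partial_sum_ge_1[OF f, of a] f_nonneg by blast
    then have "c \<le> measure (Q 0) (\<Union>R\<in>{a..<b}. single_visit R)"
      unfolding c_def f_def by (intro single_visit_block_prob[OF \<delta> bound]) (auto simp: a_def)
    also have "\<dots> \<le> measure (Q 0) (?A N)"
      using A by (intro Q.finite_measure_mono) (auto simp: a_def)
    finally show ?thesis .
  qed
  have "(\<lambda>N. measure (Q 0) (?A N)) \<longlonglongrightarrow> measure (Q 0) (\<Inter>N. ?A N)"
  proof (rule Q.finite_Lim_measure_decseq)
    show "range ?A \<subseteq> sets (Q 0)" using A by blast
    show "decseq ?A" unfolding decseq_def by force
  qed
  then have "c \<le> measure (Q 0) (\<Inter>N. ?A N)" using ge by (intro LIMSEQ_le_const) auto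
  also have "(\<Inter>N. ?A N) = infinitely_many_single"
    by (auto simp: infinitely_many_single_def)
  finally have "measure (Q 0) infinitely_many_single = 1"
    using infinitely_many_single_0_1 c by linarith
  then have "AE x in Q 0. x \<in> infinitely_many_single"
    using Q.prob_eq_1[of infinitely_many_single 0] by (simp only: sets_Q infinitely_many_single_sets)
  with AE_escaping[of 0] show ?thesis
  proof eventually_elim
    case (elim x)
    have "{R. strong_cutpoint x R} = {R. x \<in> single_visit R}"
      using strong_cutpoint_iff_single_visit[OF elim(1)] by auto
    then show ?case
      using elim(2) by (simp add: infinitely_many_single_def infinite_nat_iff_unbounded_le)
  qed
qed

end

subsection \<open>The laws of the walk from its different states\<close>

lemma AE_uniform_measure_distrD:
  assumes "AE x in distr (uniform_measure M A) N f. P x" "f \<in> M \<rightarrow>\<^sub>M N"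
    "emeasure M A \<noteq> 0" "emeasure M A < \<infinity>"
  shows "AE \<omega> in M. \<omega> \<in> A \<longrightarrow> P (f \<omega>)"
proof -
  have "AE \<omega> in uniform_measure M A. P (f \<omega>)"
    using assms(1,2) by (intro AE_distrD[of f _ N]) auto
  then show ?thesis using assms(3,4) by (subst (asm) AE_uniform_measure) auto
qed

context nn_walk
begin

definition prefix_event :: "nat \<Rightarrow> (nat \<Rightarrow> nat) \<Rightarrow> 'a set" where
  "prefix_event n x = {\<omega> \<in> space M. \<forall>k\<le>n. X k \<omega> = x k}"

text \<open>The law of the walk started at \<open>i\<close> is the conditional law of the walk after the straight
  ascent \<open>0, 1, \<dots>, i\<close>, an event of positive probability.\<close>

definition law_from :: "nat \<Rightarrow> (nat \<Rightarrow> nat) measure" where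
  "law_from i = distr (uniform_measure M (prefix_event i (\<lambda>k. k))) path_space (\<lambda>\<omega> n. X (i + n) \<omega>)"

lemma X_measurable [measurable]: "X n \<in> M \<rightarrow>\<^sub>M count_space UNIV"
  by (rule random_variable_X)

lemma prefix_event_sets [measurable]: "prefix_event n x \<in> sets M"
proof -
  have "Measurable.pred M (\<lambda>\<omega>. \<forall>k\<in>{..n}. X k \<omega> = x k)" by measurable
  then show ?thesis by (simp add: pred_def prefix_event_def Ball_def)
qed

text \<open>The Markov hypothesis is silent after a history of probability 0; in that case
  monotonicity makes the longer prefix null as well, and both sides vanish.\<close>

lemma prefix_prob:
  "prob (prefix_event n x) = (if x 0 = 0 then \<Prod>k<n. step_prob p (x k) (x (Suc k)) else 0)"
proof (induction n)
  case 0
  have "prob (prefix_event 0 x) = prob (if x 0 = 0 then space M else {})"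
    using start by (intro finite_measure_eq_AE) (auto simp: prefix_event_def elim!: eventually_mono)
  then show ?case by (simp add: prob_space)
next
  case (Suc n)
  have eq: "prefix_event (Suc n) x = {\<omega> \<in> space M. X (Suc n) \<omega> = x (Suc n) \<and> (\<forall>i\<le>n. X i \<omega> = x i)}"
    by (auto simp: prefix_event_def le_Suc_eq)
  have "prob (prefix_event (Suc n) x) = prob (prefix_event n x) * step_prob p (x n) (x (Suc n))"
  proof (cases "prob (prefix_event n x) > 0")
    case True
    then show ?thesis
      using markov[of n x "x (Suc n)"] unfolding eq
      by (simp add: cond_prob_def prefix_event_def field_simps)
  next
    case False
    have "prob (prefix_event (Suc n) x) \<le> prob (prefix_event n x)"
      by (intro finite_measure_mono) (auto simp: prefix_event_def)
    then show ?thesis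
      using False by (simp add: zero_less_measure_iff measure_le_0_iff)
  qed
  with Suc show ?case by simp
qed

text \<open>A step of probability 0 completes a null prefix, and encoding prefixes as lists leaves
  only countably many null events to discard.\<close>

lemma AE_admissible_steps: "AE \<omega> in M. X 0 \<omega> = 0 \<and> (\<forall>n. step_prob p (X n \<omega>) (X (Suc n) \<omega>) \<noteq> 0)"
proof -
  have "AE \<omega> in M. \<omega> \<notin> prefix_event n ((!) l)" if "prob (prefix_event n ((!) l)) = 0" for n and l :: "nat list"
    using that by (intro AE_not_in) (simp add: null_setsI emeasure_eq_measure)
  then have "AE \<omega> in M. \<forall>n. \<forall>l :: nat list. prob (prefix_event n ((!) l)) = 0 \<longrightarrow> \<omega> \<notin> prefix_event n ((!) l)"
    by (simp add: AE_all_countable)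
  with start AE_space show ?thesis
  proof eventually_elim
    case (elim \<omega>)
    have "step_prob p (X n \<omega>) (X (Suc n) \<omega>) \<noteq> 0" for n
    proof
      assume zero: "step_prob p (X n \<omega>) (X (Suc n) \<omega>) = 0"
      define l where "l = map (\<lambda>k. X k \<omega>) [0..<Suc (Suc n)]"
      have l: "l ! k = X k \<omega>" if "k \<le> Suc n" for k
        using that nth_map[of k "[0..<Suc (Suc n)]" "\<lambda>k. X k \<omega>"] by (simp add: l_def less_Suc_eq_le del: upt_Suc)
      have "\<omega> \<in> prefix_event (Suc n) ((!) l)" using elim l by (simp add: prefix_event_def)
      moreover have "prob (prefix_event (Suc n) ((!) l)) = 0"
        by (simp add: prefix_prob l zero)
      ultimately show False using elim by blast
    qed
    with elim show ?case by simp
  qed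
qed

text \<open>The walk rises by at most 1 per step, so being at \<open>i\<close> at time
  \<open>i\<close> forces the straight ascent. This matches the conditioning in
  \<open>transient\<close> with the one in \<open>law_from\<close>.\<close>

lemma AE_straight_prefix:
  "AE \<omega> in M. X i \<omega> = i \<longleftrightarrow> \<omega> \<in> prefix_event i (\<lambda>k. k)"
  using AE_admissible_steps AE_space
proof eventually_elim
  case (elim \<omega>)
  have step: "X (Suc n) \<omega> \<le> Suc (X n \<omega>)" for n
  proof -
    have "step_prob p (X n \<omega>) (X (Suc n) \<omega>) \<noteq> 0" using elim by blast
    then show ?thesis by (auto simp: step_prob_def split: if_splits)
  qed
  have le: "X (m + n) \<omega> \<le> X m \<omega> + n" for m n
  proof (induction n)
    case (Suc n)
    then show ?case using step[of "m + n"] by simp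
  qed simp
  have "X k \<omega> = k" if "X i \<omega> = i" "k \<le> i" for k
    using le[of 0 k] le[of k "i - k"] elim that by simp
  then show ?case using elim by (auto simp: prefix_event_def)
qed

lemma measurable_walk_from [measurable]: "(\<lambda>\<omega> n. X (i + n) \<omega>) \<in> M \<rightarrow>\<^sub>M path_space"
  by (rule measurable_into_path_space) simp

lemma straight_prefix_prob_pos:
  assumes "\<And>i. i \<ge> 1 \<Longrightarrow> 0 \<le> p i"
  shows "prob (prefix_event i (\<lambda>k. k)) > 0"
proof -
  have "step_prob p k (Suc k) > 0" for k using assms[of k] by (simp add: step_prob_def add_pos_nonneg)
  then show ?thesis by (simp add: prefix_prob prod_pos)
qed

lemma law_from_prob:
  assumes "B \<in> sets path_space" and pos: "prob (prefix_event i (\<lambda>k. k)) > 0"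
  shows "measure (law_from i) B =
    prob (prefix_event i (\<lambda>k. k) \<inter> {\<omega> \<in> space M. (\<lambda>n. X (i + n) \<omega>) \<in> B}) / prob (prefix_event i (\<lambda>k. k))"
proof -
  have "(\<lambda>\<omega> n. X (i + n) \<omega>) \<in> uniform_measure M (prefix_event i (\<lambda>k. k)) \<rightarrow>\<^sub>M path_space"
    using measurable_walk_from by simp
  then have "measure (law_from i) B = measure (uniform_measure M (prefix_event i (\<lambda>k. k)))
      {\<omega> \<in> space M. (\<lambda>n. X (i + n) \<omega>) \<in> B}"
    unfolding law_from_def using assms(1) by (subst measure_distr) (auto intro!: arg_cong2[where f = measure])
  also have "\<dots> = prob (prefix_event i (\<lambda>k. k) \<inter> {\<omega> \<in> space M. (\<lambda>n. X (i + n) \<omega>) \<in> B}) /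
      prob (prefix_event i (\<lambda>k. k))"
    using measurable_sets[OF measurable_walk_from assms(1), of i] pos
    by (intro measure_uniform_measure) (auto simp: vimage_def Int_def conj_commute emeasure_eq_measure)
  finally show ?thesis .
qed

text \<open>Cylinder probabilities are quotients of prefix probabilities, in which the ascent
  cancels. Transience enters at time \<open>n = i\<close> for state \<open>i\<close>, where
  conditioning on the position amounts to conditioning on the ascent.\<close>

lemma walk_laws_law_from:
  assumes p_range: "\<And>i. i \<ge> 1 \<Longrightarrow> 0 \<le> p i \<and> p i < 1 / 2" and transient: "transient M X"
  shows "walk_laws p law_from"
proof (rule walk_laws.intro)
  have pos: "prob (prefix_event i (\<lambda>k. k)) > 0" for i
    using p_range by (intro straight_prefix_prob_pos) auto
  show "0 \<le> p i \<and> p i < 1 / 2" if "i \<ge> 1" for i using that by (rule p_range)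
  show "prob_space (law_from i)" for i
    unfolding law_from_def using pos[of i]
    by (intro prob_space.prob_space_distr prob_space_uniform_measure)
      (auto simp: emeasure_eq_measure)
  show "sets (law_from i) = sets path_space" for i by (simp add: law_from_def)
  show "measure (law_from i) (cylinder n y) =
      (if y 0 = i then \<Prod>k<n. step_prob p (y k) (y (Suc k)) else 0)" for i n y
  proof (cases "y 0 = i")
    case True
    define z where "z k = (if k < i then k else y (k - i))" for k
    have z: "z k = k" if "k \<le> i" for k using that True by (auto simp: z_def)
    have z': "z (i + k) = y k" for k by (simp add: z_def)
    have "prefix_event i (\<lambda>k. k) \<inter> {\<omega> \<in> space M. (\<lambda>n. X (i + n) \<omega>) \<in> cylinder n y} = prefix_event (i + n) z"
    proof (intro equalityI subsetI)
      fix \<omega> assume \<omega>: "\<omega> \<in> prefix_event i (\<lambda>k. k) \<inter> {\<omega> \<in> space M. (\<lambda>n. X (i + n) \<omega>) \<in> cylinder n y}"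
      have "X k \<omega> = z k" if "k \<le> i + n" for k
      proof (cases "k \<le> i")
        case True then show ?thesis using \<omega> by (simp add: prefix_event_def z)
      next
        case False
        define d where "d = k - i"
        have "k = i + d" "d \<le> n" using False that by (auto simp: d_def)
        moreover from this have "X (i + d) \<omega> = y d" using \<omega> by (simp add: cylinder_def)
        ultimately show ?thesis using z'[of d] by simp
      qed
      then show "\<omega> \<in> prefix_event (i + n) z" using \<omega> by (simp add: prefix_event_def)
    next
      fix \<omega> assume "\<omega> \<in> prefix_event (i + n) z"
      then show "\<omega> \<in> prefix_event i (\<lambda>k. k) \<inter> {\<omega> \<in> space M. (\<lambda>n. X (i + n) \<omega>) \<in> cylinder n y}"
        using z z' by (simp add: prefix_event_def cylinder_def)
    qed
    moreover have "prob (prefix_event (i + n) z) =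
        prob (prefix_event i (\<lambda>k. k)) * (\<Prod>k<n. step_prob p (y k) (y (Suc k)))"
    proof -
      have "(\<Prod>k<i. step_prob p (z k) (z (Suc k))) = (\<Prod>k<i. step_prob p k (Suc k))"
        by (intro prod.cong) (auto simp: z)
      moreover have "(\<Prod>k<n. step_prob p (z (i + k)) (z (Suc (i + k)))) = (\<Prod>k<n. step_prob p (y k) (y (Suc k)))"
        using z' by (intro prod.cong refl) (metis add_Suc_right)
      ultimately show ?thesis by (simp add: prefix_prob prod_lessThan_add z)
    qed
    ultimately show ?thesis using True pos[of i] by (simp add: law_from_prob[OF cylinder_sets pos])
  next
    case False
    then have "prefix_event i (\<lambda>k. k) \<inter> {\<omega> \<in> space M. (\<lambda>n. X (i + n) \<omega>) \<in> cylinder n y} = {}"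
      by (auto simp: prefix_event_def cylinder_def)
    then show ?thesis using False by (simp add: law_from_prob[OF cylinder_sets pos])
  qed
  show "measure (law_from i) {x. \<exists>m>0. x m = i} < 1" for i
  proof -
    let ?E = "{\<omega> \<in> space M. \<exists>m>i. X m \<omega> = i}"
    let ?I = "{\<omega> \<in> space M. X i \<omega> = i}"
    have E: "?E \<in> events" and I: "?I \<in> events" by measurable
    have B: "{x. \<exists>m>0. x m = i} \<in> sets path_space"
    proof -
      have "Measurable.pred path_space (\<lambda>x. \<exists>m>0. x m = i)" by measurable
      then show ?thesis by (simp add: pred_def)
    qed
    have "{\<omega> \<in> space M. (\<lambda>n. X (i + n) \<omega>) \<in> {x. \<exists>m>0. x m = i}} = ?E"
    proof -
      have "(\<exists>m>0. X (i + m) \<omega> = i) \<longleftrightarrow> (\<exists>m>i. X m \<omega> = i)" for \<omega>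
        by (metis add_diff_inverse_nat less_add_same_cancel1 not_less_iff_gr_or_eq zero_less_diff)
      then show ?thesis by auto
    qed
    then have "measure (law_from i) {x. \<exists>m>0. x m = i} =
        prob (prefix_event i (\<lambda>k. k) \<inter> ?E) / prob (prefix_event i (\<lambda>k. k))"
      using law_from_prob[OF B pos, of i] by simp
    also have "prob (prefix_event i (\<lambda>k. k)) = prob ?I"
    proof (rule finite_measure_eq_AE)
      show "AE \<omega> in M. \<omega> \<in> prefix_event i (\<lambda>k. k) \<longleftrightarrow> \<omega> \<in> ?I"
        using AE_straight_prefix[of i] AE_space by eventually_elim simp
    qed (use I in auto)
    also have "prob (prefix_event i (\<lambda>k. k) \<inter> ?E) = prob (?I \<inter> ?E)"
    proof (rule finite_measure_eq_AE)
      show "AE \<omega> in M. \<omega> \<in> prefix_event i (\<lambda>k. k) \<inter> ?E \<longleftrightarrow> \<omega> \<in> ?I \<inter> ?E"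
        using AE_straight_prefix[of i] AE_space by eventually_elim simp
    qed (use E I in auto)
    also have "?I \<inter> ?E = {\<omega> \<in> space M. (\<exists>m>i. X m \<omega> = i) \<and> X i \<omega> = i}" by auto
    also have "prob \<dots> / prob ?I = \<P>(\<omega> in M. (\<exists>m>i. X m \<omega> = i) \<bar> X i \<omega> = i)"
      by (simp add: cond_prob_def)
    also have "\<dots> < 1"
    proof -
      have "prob ?I > 0"
      proof -
        have "prob (prefix_event i (\<lambda>k. k)) \<le> prob ?I"
          using I by (intro finite_measure_mono) (auto simp: prefix_event_def)
        then show ?thesis using pos[of i] by linarith
      qed
      then show ?thesis using transient unfolding transient_def by blast
    qed
    finally show ?thesis .
  qed
qed

lemma AE_law_from_0:
  assumes "AE x in law_from 0. P x"
  shows "AE \<omega> in M. P (\<lambda>n. X n \<omega>)"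
proof -
  have "prob (prefix_event 0 (\<lambda>k. k)) = 1" by (simp add: prefix_prob)
  then have "AE \<omega> in M. \<omega> \<in> prefix_event 0 (\<lambda>k. k) \<longrightarrow> P (\<lambda>n. X (0 + n) \<omega>)"
    using assms unfolding law_from_def
    by (intro AE_uniform_measure_distrD[OF _ measurable_walk_from]) (auto simp: emeasure_eq_measure)
  with start AE_space show ?thesis by eventually_elim (simp add: prefix_event_def)
qed

end

theorem theorem1p1:
  fixes M :: "'a measure" and p :: "nat \<Rightarrow> real" and X :: "nat \<Rightarrow> 'a \<Rightarrow> nat"
  assumes p_range: "\<And>i. i \<ge> 1 \<Longrightarrow> 0 \<le> p i \<and> p i < 1 / 2"
    and walk: "nn_walk M p X"
    and transient: "transient M X"
  shows "(\<forall>n\<ge>1. summable (\<lambda>j. \<Prod>i = 1..Suc j. U p (n + i))) \<and>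
    (summable (\<lambda>n. 1 / (D p (n + 2) * ln (real (n + 2)))) \<longrightarrow>
      (AE \<omega> in M. finite {R. cutpoint (\<lambda>n. X n \<omega>) R})) \<and>
    ((\<exists>\<delta>>0. \<exists>n0. \<forall>n\<ge>n0. D p n \<le> \<delta> * real n * ln (real n)) \<longrightarrow>
      \<not> summable (\<lambda>n. 1 / (D p (n + 2) * ln (real (n + 2)))) \<longrightarrow>
      (AE \<omega> in M. infinite {R. strong_cutpoint (\<lambda>n. X n \<omega>) R}))"
proof -
  interpret nn_walk M p X by (rule walk)
  interpret laws: walk_laws p law_from by (rule walk_laws_law_from[OF p_range transient])
  show ?thesis
  proof (intro conjI impI allI)
    show "summable (\<lambda>j. \<Prod>i = 1..Suc j. U p (n + i))" for n
      by (rule laws.summable_D)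
  next
    assume "summable (\<lambda>n. 1 / (D p (n + 2) * ln (real (n + 2))))"
    then show "AE \<omega> in M. finite {R. cutpoint (\<lambda>n. X n \<omega>) R}"
      by (intro AE_law_from_0 laws.AE_finitely_many_cuts)
  next
    assume "\<exists>\<delta>>0. \<exists>n0. \<forall>n\<ge>n0. D p n \<le> \<delta> * real n * ln (real n)"
    then obtain \<delta> n0 where bound: "\<delta> > 0" "\<And>n. n \<ge> n0 \<Longrightarrow> D p n \<le> \<delta> * real n * ln (real n)" by blast
    assume "\<not> summable (\<lambda>n. 1 / (D p (n + 2) * ln (real (n + 2))))"
    from laws.AE_infinitely_many_strong_cutpoints[OF bound this]
    show "AE \<omega> in M. infinite {R. strong_cutpoint (\<lambda>n. X n \<omega>) R}"
      by (rule AE_law_from_0)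
  qed
qed

end
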